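(* Let $\mathcal{M}_1=\{A\in\mathbb{C}^{3\times3}\mid\deg(m_A)\le 2\}$ and $\mathcal{N}_1=\{A\in\mathcal{M}_1\mid\mathrm{tr}(A)=0\}$, and denote by a bar the restriction of a function on $\mathbb{C}^{3\times3}$ to $\mathcal{M}_1$. Then: (i) $\mathbb{C}[\mathcal{M}_1]^U$ is a polynomial ring in $\overline{d_1}$ over the subalgebra $\mathbb{C}[\mathcal{N}_1]^U$. (ii) There is a $\mathbb{C}$-algebra isomorphism $\eta:\mathbb{C}[z^2,z^3,D,zD]\to\mathbb{C}[\mathcal{N}_1]^U$ with $\eta(z^2)=\overline{d_2}$, $\eta(z^3)=\overline{d_3}$, $\eta(D)=\overline{c_1^U}$, $\eta(zD)=\overline{c_2^U}$, where $\mathbb{C}[z^2,z^3,D,zD]$ is the subalgebra of the polynomial ring $\mathbb{C}[z,D]$ generated by these monomials. (iii) The kernel of the surjection $\varphi:\mathbb{C}[x_0,x_1,x_2,x_3,x_4]\to\mathbb{C}[\mathcal{M}_1]^U$, $x_0\mapsto\overline{d_1}$, $x_1\mapsto\overline{d_2}$, $x_2\mapsto\overline{d_3}$, $x_3\mapsto\overline{c_1^U}$, $x_4\mapsto\overline{c_2^U}$, is generated as an ideal by $x_1^3-x_2^2$, $x_1x_4-x_2x_3$, $x_4^2-x_1x_3^2$, $x_2x_4-x_1^2x_3$.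
   Context: $m_A$ is the minimal polynomial. $G=SL(3,\mathbb{C})$ acts on $\mathbb{C}^{3\times3}$ by conjugation and on functions by $(g\cdot f)(A)=f(g^{-1}Ag)$; $\mathcal{M}_1,\mathcal{N}_1$ are $G$-stable. $U$ is the group of upper unitriangular $3\times3$ matrices; $\mathbb{C}[X]^U$ denotes $U$-invariants in the coordinate ring $\mathbb{C}[X]$. $\mathbb{C}[\mathcal{N}_1]$ is viewed as a subalgebra of $\mathbb{C}[\mathcal{M}_1]$ via $f\mapsto f\circ c_1$. For $A\in\mathbb{C}^{3\times3}$: $c_1(A)=A-\frac13\mathrm{tr}(A)I_3$, $d_1(A)=\mathrm{tr}(A)$, $d_2(A)=\frac16\mathrm{tr}(c_1(A)^2)$, $d_3(A)=\frac12\det(c_1(A))$. The functions $c_1^U,c_2^U$ are the highest weight vectors associated with the covariants $c_1(A)$ and $c_2(A)=c_1(c_1(A)^2)$, normalized so that $\overline{d_3}\,\overline{c_1^U}=\overline{d_2}\,\overline{c_2^U}$; concretely one may take $c_1^U(A)=a_{31}$ (the $(3,1)$ entry of $A$) and $c_2^U(A)=(c_1(A)^2)_{31}$. *)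

theory Defs
  imports "Jordan_Normal_Form.Determinant" "HOL-Computational_Algebra.Polynomial"
begin

text \<open>Polynomial functions in the variables indexed by I (complex coefficients).
  Over the infinite field of complex numbers these are in bijection with polynomials.\<close>
inductive_set polyfun :: "'i set \<Rightarrow> (('i \<Rightarrow> complex) \<Rightarrow> complex) set" for I :: "'i set" where
  pf_const: "(\<lambda>x. c) \<in> polyfun I"
| pf_var: "i \<in> I \<Longrightarrow> (\<lambda>x. x i) \<in> polyfun I"
| pf_add: "p \<in> polyfun I \<Longrightarrow> q \<in> polyfun I \<Longrightarrow> (\<lambda>x. p x + q x) \<in> polyfun I"
| pf_mult: "p \<in> polyfun I \<Longrightarrow> q \<in> polyfun I \<Longrightarrow> (\<lambda>x. p x * q x) \<in> polyfun I"

inductive_set gen_subalg :: "(('i \<Rightarrow> complex) \<Rightarrow> complex) set \<Rightarrow> (('i \<Rightarrow> complex) \<Rightarrow> complex) set"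
  for G where
  ga_const: "(\<lambda>x. c) \<in> gen_subalg G"
| ga_gen: "g \<in> G \<Longrightarrow> g \<in> gen_subalg G"
| ga_add: "p \<in> gen_subalg G \<Longrightarrow> q \<in> gen_subalg G \<Longrightarrow> (\<lambda>x. p x + q x) \<in> gen_subalg G"
| ga_mult: "p \<in> gen_subalg G \<Longrightarrow> q \<in> gen_subalg G \<Longrightarrow> (\<lambda>x. p x * q x) \<in> gen_subalg G"

definition mat_polyfun :: "(complex mat \<Rightarrow> complex) set" where
  "mat_polyfun = {f. \<exists>p \<in> polyfun ({..<3} \<times> {..<3}).
      \<forall>A \<in> carrier_mat 3 3. f A = p (\<lambda>ij. A $$ ij)}"

text \<open>Restriction to a subset S (functions are represented canonically, being 0 off S).\<close>
definition restr :: "complex mat set \<Rightarrow> (complex mat \<Rightarrow> complex) \<Rightarrow> complex mat \<Rightarrow> complex" where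
  "restr S f = (\<lambda>A. if A \<in> S then f A else 0)"

definition coord_ring :: "complex mat set \<Rightarrow> (complex mat \<Rightarrow> complex) set" where
  "coord_ring S = restr S ` mat_polyfun"

definition U3 :: "complex mat set" where
  "U3 = {u \<in> carrier_mat 3 3. \<forall>i<3. \<forall>j<3.
           (j < i \<longrightarrow> u $$ (i,j) = 0) \<and> (i = j \<longrightarrow> u $$ (i,j) = 1)}"

definition U_invariants :: "complex mat set \<Rightarrow> (complex mat \<Rightarrow> complex) set" where
  "U_invariants S = {f \<in> coord_ring S. \<forall>u \<in> U3. \<forall>v \<in> carrier_mat 3 3.
      v * u = 1\<^sub>m 3 \<longrightarrow> (\<forall>A \<in> carrier_mat 3 3. f (v * A * u) = f A)}"

definition tr :: "complex mat \<Rightarrow> complex" where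
  "tr A = (\<Sum>i<dim_row A. A $$ (i,i))"

definition mat_poly_eval :: "complex poly \<Rightarrow> complex mat \<Rightarrow> complex mat" where
  "mat_poly_eval p A = foldr (\<lambda>c M. c \<cdot>\<^sub>m 1\<^sub>m (dim_row A) + A * M) (coeffs p) (0\<^sub>m (dim_row A) (dim_row A))"

definition minpoly_degree :: "complex mat \<Rightarrow> nat" where
  "minpoly_degree A = (LEAST n. \<exists>p. lead_coeff p = 1 \<and> degree p = n \<and>
       mat_poly_eval p A = 0\<^sub>m (dim_row A) (dim_row A))"

definition M1 :: "complex mat set" where
  "M1 = {A \<in> carrier_mat 3 3. minpoly_degree A \<le> 2}"

definition N1 :: "complex mat set" where
  "N1 = {A \<in> M1. tr A = 0}"

definition c1 :: "complex mat \<Rightarrow> complex mat" where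
  "c1 A = A - (tr A / 3) \<cdot>\<^sub>m 1\<^sub>m 3"

definition d1 :: "complex mat \<Rightarrow> complex" where "d1 A = tr A"
definition d2 :: "complex mat \<Rightarrow> complex" where "d2 A = tr (c1 A * c1 A) / 6"
definition d3 :: "complex mat \<Rightarrow> complex" where "d3 A = det (c1 A) / 2"
definition c1U :: "complex mat \<Rightarrow> complex" where "c1U A = A $$ (2,0)"
definition c2U :: "complex mat \<Rightarrow> complex" where "c2U A = (c1 A * c1 A) $$ (2,0)"

text \<open>Embedding of C[N1] into C[M1] via f \<mapsto> f \<circ> c1.\<close>
definition emb :: "(complex mat \<Rightarrow> complex) \<Rightarrow> complex mat \<Rightarrow> complex" where
  "emb f = restr M1 (\<lambda>A. f (c1 A))"

definition phi :: "((nat \<Rightarrow> complex) \<Rightarrow> complex) \<Rightarrow> complex mat \<Rightarrow> complex" where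
  "phi P = restr M1 (\<lambda>A. P (\<lambda>i. if i = 0 then d1 A else if i = 1 then d2 A else
             if i = 2 then d3 A else if i = 3 then c1U A else c2U A))"

definition rel :: "nat \<Rightarrow> (nat \<Rightarrow> complex) \<Rightarrow> complex" where
  "rel k = (if k = 0 then (\<lambda>x. x 1 ^ 3 - x 2 ^ 2)
            else if k = 1 then (\<lambda>x. x 1 * x 4 - x 2 * x 3)
            else if k = 2 then (\<lambda>x. x 4 ^ 2 - x 1 * x 3 ^ 2)
            else (\<lambda>x. x 2 * x 4 - x 1 ^ 2 * x 3))"

definition rel_ideal :: "((nat \<Rightarrow> complex) \<Rightarrow> complex) set" where
  "rel_ideal = {(\<lambda>x. \<Sum>k<4. h k x * rel k x) | h. \<forall>k<4. h k \<in> polyfun {..<5}}"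

text \<open>C[z,D] as polynomial functions in x 0 = z and x 1 = D; its subalgebra C[z^2,z^3,D,zD].\<close>
definition zD_subalg :: "((nat \<Rightarrow> complex) \<Rightarrow> complex) set" where
  "zD_subalg = gen_subalg {(\<lambda>x. x 0 ^ 2), (\<lambda>x. x 0 ^ 3), (\<lambda>x. x 1), (\<lambda>x. x 0 * x 1)}"

end

theory Submission
  imports Defs
begin

text \<open>
  A matrix with minimal polynomial of degree at most \<open>2\<close> is a scalar plus a matrix \<open>v w\<^sup>T\<close> of rank at
  most one. With \<open>t\<close> its trace, \<open>z = (v \<bullet> w) / 3\<close> and \<open>D = v\<^sub>3 w\<^sub>1\<close>, the five functions
  \<open>d1, d2, d3, c1U, c2U\<close> take the values \<open>t, z\<^sup>2, z\<^sup>3, D, z D\<close>. If \<open>D \<noteq> 0\<close>, conjugation by \<open>U\<close>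
  brings the matrix to a normal form depending only on \<open>(t, z, D)\<close>, so by density every invariant is a
  polynomial \<open>Q(t, z, D)\<close>. The matrices with \<open>D = 0\<close> include three diagonal ones with the same \<open>t, z\<close>
  whose derivatives in \<open>z\<close> add up to zero; hence \<open>\<partial>Q/\<partial>z\<close> vanishes at \<open>z = D = 0\<close>, and splitting \<open>Q\<close>
  into even and odd parts in \<open>z\<close> gives
  \<open>Q = A(t, z\<^sup>2, D) + z\<^sup>3 B(t, z\<^sup>2) + z D C(t, z\<^sup>2, D)\<close>. Modulo the four relations every polynomial
  has the corresponding form \<open>A(x\<^sub>0, x\<^sub>1, x\<^sub>3) + x\<^sub>2 B(x\<^sub>0, x\<^sub>1) + x\<^sub>4 C(x\<^sub>0, x\<^sub>1, x\<^sub>3)\<close>, and parity in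
  \<open>z\<close> shows that such a form vanishes on all \<open>(t, z\<^sup>2, z\<^sup>3, D, z D)\<close> only if \<open>A = B = C = 0\<close>.
\<close>

section \<open>Polynomial functions\<close>

lemma polyfun_uminus: "p \<in> polyfun I \<Longrightarrow> (\<lambda>x. - p x) \<in> polyfun I"
  using pf_mult[OF pf_const[of "-1"], of p I] by simp

lemma polyfun_diff:
  assumes "p \<in> polyfun I" "q \<in> polyfun I"
  shows "(\<lambda>x. p x - q x) \<in> polyfun I"
  using pf_add[OF assms(1) polyfun_uminus[OF assms(2)]] by simp

lemma polyfun_power: "p \<in> polyfun I \<Longrightarrow> (\<lambda>x. p x ^ n) \<in> polyfun I"
  by (induction n) (auto intro: pf_const pf_mult)

lemmas polyfun_intros = pf_const pf_var pf_add pf_mult polyfun_uminus polyfun_diff polyfun_power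

lemma polyfun_compose:
  assumes "p \<in> polyfun I" "\<And>i. i \<in> I \<Longrightarrow> f i \<in> polyfun J"
  shows "(\<lambda>x. p (\<lambda>i. f i x)) \<in> polyfun J"
  using assms(1) by induction (simp_all add: polyfun.intros assms(2))

lemma polyfun_mono:
  assumes "p \<in> polyfun I" "I \<subseteq> J"
  shows "p \<in> polyfun J"
  using assms(1) by induction (use assms(2) in \<open>auto intro: polyfun.intros\<close>)

lemma polyfun_cong:
  assumes "p \<in> polyfun I" "\<And>i. i \<in> I \<Longrightarrow> x i = y i"
  shows "p x = p y"
  using assms(1) by induction (auto simp: assms(2))

lemma polyfun_fix_var:
  assumes "p \<in> polyfun I"
  shows "(\<lambda>x. p (x(i := c))) \<in> polyfun (I - {i})"
proof -
  have "(\<lambda>x. if j = i then c else x j) \<in> polyfun (I - {i})" if "j \<in> I" for j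
    using that by (cases "j = i") (auto intro: pf_const pf_var)
  then show ?thesis unfolding fun_upd_def by (rule polyfun_compose[OF assms])
qed

text \<open>Division by the coordinate \<open>x i\<close>, with the value at \<open>x i = 0\<close>
  as remainder. Products telescope: \<open>p q - p0 q0 = (p - p0) q + p0 (q - q0)\<close>. Later
  this peels \<open>x 3\<close> and \<open>x 1\<close> off a polynomial.\<close>

lemma polyfun_split_var:
  assumes "p \<in> polyfun I" "i \<in> I"
  obtains q where "q \<in> polyfun I" "\<And>x. p x = p (x(i := 0)) + x i * q x"
proof -
  from assms(1) have "\<exists>q \<in> polyfun I. \<forall>x. p x = p (x(i := 0)) + x i * q x"
  proof induction
    case (pf_const c)
    show ?case by (rule bexI[of _ "\<lambda>x. 0"]) (auto intro: polyfun.pf_const)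
  next
    case (pf_var j)
    show ?case
      by (rule bexI[of _ "\<lambda>x. if j = i then 1 else 0"]) (auto intro: polyfun.pf_const)
  next
    case (pf_add p q)
    then obtain p' q' where *: "p' \<in> polyfun I" "\<And>x. p x = p (x(i := 0)) + x i * p' x"
      "q' \<in> polyfun I" "\<And>x. q x = q (x(i := 0)) + x i * q' x" by blast
    have "p x + q x = p (x(i := 0)) + q (x(i := 0)) + x i * (p' x + q' x)" for x
      by (subst *(2), subst *(4)) (simp only: algebra_simps)
    then show ?case
      by (rule bexI[of _ "\<lambda>x. p' x + q' x", OF allI]) (rule polyfun.pf_add[OF *(1,3)])
  next
    case (pf_mult p q)
    then obtain p' q' where *: "p' \<in> polyfun I" "\<And>x. p x = p (x(i := 0)) + x i * p' x"
      "q' \<in> polyfun I" "\<And>x. q x = q (x(i := 0)) + x i * q' x" by blast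
    let ?r = "\<lambda>x. p' x * q x + p (x(i := 0)) * q' x"
    have r: "p x * q x = p (x(i := 0)) * q (x(i := 0)) + x i * ?r x" for x
    proof -
      have "p x * q x - p (x(i := 0)) * q (x(i := 0))
        = (p x - p (x(i := 0))) * q x + p (x(i := 0)) * (q x - q (x(i := 0)))"
        by (simp add: algebra_simps)
      also have "\<dots> = x i * ?r x"
        using *(2)[of x] *(4)[of x] by (simp only: add_diff_cancel_left') (simp only: algebra_simps)
      finally show ?thesis by (simp add: algebra_simps)
    qed
    have "(\<lambda>x. p (x(i := 0))) \<in> polyfun I"
      using polyfun_mono[OF polyfun_fix_var[OF pf_mult.hyps(1)]] by auto
    then have "?r \<in> polyfun I" by (intro polyfun_intros *(1,3) pf_mult.hyps)
    with r show ?case by (intro bexI[of _ ?r, OF allI])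
  qed
  then show thesis using that by blast
qed

text \<open>Even and odd part in one variable, each written as a polynomial in its square. It serves
  to split an invariant, seen as a polynomial in \<open>t, z, D\<close>, by parity in
  \<open>z\<close>.\<close>

lemma polyfun_even_odd:
  assumes "p \<in> polyfun I" "i \<in> I"
  obtains a b where "a \<in> polyfun I" "b \<in> polyfun I"
    "\<And>x. p x = a (x(i := x i ^ 2)) + x i * b (x(i := x i ^ 2))"
proof -
  from assms(1) have "\<exists>a \<in> polyfun I. \<exists>b \<in> polyfun I.
    \<forall>x. p x = a (x(i := x i ^ 2)) + x i * b (x(i := x i ^ 2))"
  proof induction
    case (pf_const c)
    show ?case
      by (rule bexI[of _ "\<lambda>x. c"], rule bexI[of _ "\<lambda>x. 0"]) (auto intro: polyfun.pf_const)
  next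
    case (pf_var j)
    show ?case
    proof (cases "j = i")
      case True
      then show ?thesis
        by (rule_tac bexI[of _ "\<lambda>x. 0"], rule_tac bexI[of _ "\<lambda>x. 1"])
          (auto intro: polyfun.pf_const)
    next
      case False
      then show ?thesis using pf_var
        by (rule_tac bexI[of _ "\<lambda>x. x j"], rule_tac bexI[of _ "\<lambda>x. 0"])
          (auto intro: polyfun.intros)
    qed
  next
    case (pf_add p q)
    then obtain a b a' b' where *: "a \<in> polyfun I" "b \<in> polyfun I" "a' \<in> polyfun I" "b' \<in> polyfun I"
      "\<And>x. p x = a (x(i := x i ^ 2)) + x i * b (x(i := x i ^ 2))"
      "\<And>x. q x = a' (x(i := x i ^ 2)) + x i * b' (x(i := x i ^ 2))" by blast
    have "p x + q x = a (x(i := x i ^ 2)) + a' (x(i := x i ^ 2))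
        + x i * (b (x(i := x i ^ 2)) + b' (x(i := x i ^ 2)))" for x
      unfolding *(5,6) by (simp only: algebra_simps)
    then show ?case
      by (rule bexI[of _ "\<lambda>x. a x + a' x", OF bexI[of _ "\<lambda>x. b x + b' x", OF allI]])
        (intro polyfun.pf_add *(1-4))+
  next
    case (pf_mult p q)
    then obtain a b a' b' where *: "a \<in> polyfun I" "b \<in> polyfun I" "a' \<in> polyfun I" "b' \<in> polyfun I"
      "\<And>x. p x = a (x(i := x i ^ 2)) + x i * b (x(i := x i ^ 2))"
      "\<And>x. q x = a' (x(i := x i ^ 2)) + x i * b' (x(i := x i ^ 2))" by blast
    have eq: "p x * q x = a (x(i := x i ^ 2)) * a' (x(i := x i ^ 2))
        + x i ^ 2 * (b (x(i := x i ^ 2)) * b' (x(i := x i ^ 2)))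
        + x i * (a (x(i := x i ^ 2)) * b' (x(i := x i ^ 2)) + b (x(i := x i ^ 2)) * a' (x(i := x i ^ 2)))"
      for x
      unfolding *(5,6) by (simp only: algebra_simps power2_eq_square)
    show ?case
    \<comment> \<open>The factor in front of \<open>b x * b' x\<close> is \<open>x i\<close> and not
      its square, since the witness is evaluated where coordinate \<open>i\<close> has already been
      squared.\<close>
    proof (rule bexI[of _ "\<lambda>x. a x * a' x + x i * (b x * b' x)"],
        rule bexI[of _ "\<lambda>x. a x * b' x + b x * a' x"])
      show "(\<lambda>x. a x * a' x + x i * (b x * b' x)) \<in> polyfun I"
        by (intro polyfun.pf_add polyfun.pf_mult polyfun.pf_var assms(2) *(1-4))
      show "(\<lambda>x. a x * b' x + b x * a' x) \<in> polyfun I"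
        by (intro polyfun.pf_add polyfun.pf_mult *(1-4))
    qed (use eq in \<open>simp only: fun_upd_same simp_thms\<close>)
  qed
  then show thesis using that by blast
qed

lemma polyfun_expand_var:
  assumes "p \<in> polyfun I"
  obtains n and g :: "nat \<Rightarrow> ('i \<Rightarrow> complex) \<Rightarrow> complex"
  where "\<And>k. g k \<in> polyfun (I - {i})" "\<And>x. p x = (\<Sum>k\<le>n. g k x * x i ^ k)"
proof -
  \<comment> \<open>The degree of \<open>q x\<close> may drop at special \<open>x\<close>; a bound
    valid for all \<open>x\<close> is carried through the induction so that one \<open>n\<close>
    serves in the end.\<close>
  have "\<exists>q. (\<forall>k. (\<lambda>x. coeff (q x) k) \<in> polyfun (I - {i})) \<and>
    (\<exists>n. \<forall>x. degree (q x) \<le> n) \<and> (\<forall>x. p x = poly (q x) (x i))"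
    using assms
  proof induction
    case (pf_const c)
    show ?case
      by (rule exI[of _ "\<lambda>x. [:c:]"]) (auto simp: coeff_pCons split: nat.split intro: polyfun.pf_const)
  next
    case (pf_var j)
    show ?case
    proof (cases "j = i")
      case True
      then show ?thesis
        by (intro exI[of _ "\<lambda>x. [:0, 1:]"]) (auto intro: polyfun.pf_const)
    next
      case False
      have "(\<lambda>x. coeff [:x j:] k) \<in> polyfun (I - {i})" for k
        using False pf_var by (cases k) (auto intro: polyfun.intros)
      then show ?thesis by (intro exI[of _ "\<lambda>x. [:x j:]"]) auto
    qed
  next
    case (pf_add p q)
    then obtain p' q' m n where *:
      "\<And>k. (\<lambda>x. coeff (p' x) k) \<in> polyfun (I - {i})" "\<And>x. degree (p' x) \<le> m"
      "\<And>x. p x = poly (p' x) (x i)"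
      "\<And>k. (\<lambda>x. coeff (q' x) k) \<in> polyfun (I - {i})" "\<And>x. degree (q' x) \<le> n"
      "\<And>x. q x = poly (q' x) (x i)" by blast
    have "(\<lambda>x. coeff (p' x + q' x) k) \<in> polyfun (I - {i})" for k
      unfolding coeff_add by (rule polyfun.pf_add[OF *(1,4)])
    moreover have "degree (p' x + q' x) \<le> m + n" for x
      using degree_add_le_max[of "p' x" "q' x"] *(2,5)[of x] by linarith
    ultimately show ?case
      using *(3,6) by (intro exI[of _ "\<lambda>x. p' x + q' x"] conjI exI[of _ "m + n"]) simp_all
  next
    case (pf_mult p q)
    then obtain p' q' m n where *:
      "\<And>k. (\<lambda>x. coeff (p' x) k) \<in> polyfun (I - {i})" "\<And>x. degree (p' x) \<le> m"
      "\<And>x. p x = poly (p' x) (x i)"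
      "\<And>k. (\<lambda>x. coeff (q' x) k) \<in> polyfun (I - {i})" "\<And>x. degree (q' x) \<le> n"
      "\<And>x. q x = poly (q' x) (x i)" by blast
    have sum_closed: "(\<lambda>x. \<Sum>l\<le>N. f l x) \<in> polyfun (I - {i})"
      if "\<And>l. f l \<in> polyfun (I - {i})" for f and N :: nat
      by (induction N) (auto intro: polyfun.pf_add that)
    have "(\<lambda>x. coeff (p' x * q' x) k) \<in> polyfun (I - {i})" for k
      unfolding coeff_mult by (rule sum_closed) (rule polyfun.pf_mult[OF *(1,4)])
    moreover have "degree (p' x * q' x) \<le> m + n" for x
      using degree_mult_le[of "p' x" "q' x"] *(2,5)[of x] by linarith
    ultimately show ?case
      using *(3,6) by (intro exI[of _ "\<lambda>x. p' x * q' x"] conjI exI[of _ "m + n"]) simp_all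
  qed
  then obtain q n where q: "\<And>k. (\<lambda>x. coeff (q x) k) \<in> polyfun (I - {i})"
    "\<And>x. degree (q x) \<le> n" "\<And>x. p x = poly (q x) (x i)" by blast
  have "p x = (\<Sum>k\<le>n. coeff (q x) k * x i ^ k)" for x
    unfolding q(3) poly_altdef using q(2)[of x]
    by (intro sum.mono_neutral_left) (auto simp: coeff_eq_0)
  with q(1) show thesis by (rule that)
qed

section \<open>Continuity and derivatives of polynomial functions\<close>

lemma polyfun_isCont:
  assumes "p \<in> polyfun I" "\<And>i. i \<in> I \<Longrightarrow> isCont (f i) a"
  shows "isCont (\<lambda>s. p (\<lambda>i. f i s)) a"
  using assms(1) by induction (simp_all add: assms(2) isCont_add isCont_mult)

lemma polyfun_field_differentiable:
  assumes "p \<in> polyfun I" "\<And>i. i \<in> I \<Longrightarrow> \<exists>d. (f i has_field_derivative d) (at a)"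
  shows "\<exists>d. ((\<lambda>s :: complex. p (\<lambda>i. f i s)) has_field_derivative d) (at a)"
  using assms(1)
proof induction
  case (pf_const c)
  show ?case using DERIV_const by blast
next
  case (pf_var i)
  then show ?case using assms(2) by simp
next
  case (pf_add p q)
  then show ?case using DERIV_add by blast
next
  case (pf_mult p q)
  then show ?case using DERIV_mult by blast
qed

text \<open>\<open>l\<close> is the gradient at \<open>a\<close>. It is chosen before the direction
  \<open>d\<close>, so derivatives along several directions can be added.\<close>

lemma polyfun_directional_derivative:
  assumes "p \<in> polyfun I" "finite I"
  obtains l where "\<And>d. ((\<lambda>s. p (\<lambda>i. a i + s * d i)) has_field_derivative (\<Sum>i\<in>I. l i * d i)) (at 0)"
proof -
  have "\<exists>l. \<forall>d. ((\<lambda>s. p (\<lambda>i. a i + s * d i)) has_field_derivative (\<Sum>i\<in>I. l i * d i)) (at 0)"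
    using assms(1)
  proof induction
    case (pf_const c)
    show ?case by (rule exI[of _ "\<lambda>i. 0"]) simp
  next
    case (pf_var j)
    have "((\<lambda>s. a j + s * d j) has_field_derivative d j) (at 0)" for d
      by (auto intro!: derivative_eq_intros)
    moreover have "(\<Sum>i\<in>I. (if i = j then 1 else 0) * d i) = (\<Sum>i\<in>I. if i = j then d i else 0)"
      for d :: "'a \<Rightarrow> complex"
      by (rule sum.cong) auto
    ultimately show ?case using pf_var assms(2)
      by (intro exI[of _ "\<lambda>i. if i = j then 1 else 0"]) simp
  next
    case (pf_add p q)
    then obtain l m where
      "\<And>d. ((\<lambda>s. p (\<lambda>i. a i + s * d i)) has_field_derivative (\<Sum>i\<in>I. l i * d i)) (at 0)"
      "\<And>d. ((\<lambda>s. q (\<lambda>i. a i + s * d i)) has_field_derivative (\<Sum>i\<in>I. m i * d i)) (at 0)"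
      by blast
    from DERIV_add[OF this, of d d for d] show ?case
      by (intro exI[of _ "\<lambda>i. l i + m i"]) (simp add: distrib_right sum.distrib)
  next
    case (pf_mult p q)
    then obtain l m where
      "\<And>d. ((\<lambda>s. p (\<lambda>i. a i + s * d i)) has_field_derivative (\<Sum>i\<in>I. l i * d i)) (at 0)"
      "\<And>d. ((\<lambda>s. q (\<lambda>i. a i + s * d i)) has_field_derivative (\<Sum>i\<in>I. m i * d i)) (at 0)"
      by blast
    from DERIV_mult[OF this, of d d for d] show ?case
      by (intro exI[of _ "\<lambda>i. l i * q a + m i * p a"])
        (simp add: distrib_left distrib_right sum.distrib sum_distrib_left sum_distrib_right mult_ac)
  qed
  then show thesis using that by blast
qed

text \<open>The density arguments below are all run along one complex parameter and end here, with
  uniqueness of limits.\<close>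

lemma isCont_eq_at_limit:
  fixes f g :: "complex \<Rightarrow> complex"
  assumes "isCont f a" "isCont g a" "eventually (\<lambda>s. f s = g s) (at a)"
  shows "f a = g a"
proof -
  have "(g \<longlongrightarrow> f a) (at a)"
    using assms(1) tendsto_cong[OF assms(3)] unfolding isCont_def by metis
  then show ?thesis using assms(2) LIM_unique unfolding isCont_def by metis
qed

section \<open>Matrices with minimal polynomial of degree at most two\<close>

lemma less_3_iff: "i < 3 \<longleftrightarrow> i = 0 \<or> i = 1 \<or> i = (2::nat)"
  by auto

lemma mult_mat_3:
  fixes A B :: "'a :: comm_ring_1 mat"
  assumes "A \<in> carrier_mat 3 3" "B \<in> carrier_mat 3 3" "i < 3" "j < 3"
  shows "(A * B) $$ (i,j) = A $$ (i,0) * B $$ (0,j) + A $$ (i,1) * B $$ (1,j) + A $$ (i,2) * B $$ (2,j)"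
  using assms by (auto simp: scalar_prod_def numeral_3_eq_3 numeral_2_eq_2)

lemma tr_3: "A \<in> carrier_mat 3 3 \<Longrightarrow> tr A = A $$ (0,0) + A $$ (1,1) + A $$ (2,2)"
  by (simp add: tr_def numeral_3_eq_3 numeral_2_eq_2)

lemma det_3:
  fixes A :: "'a :: comm_ring_1 mat"
  assumes A: "A \<in> carrier_mat 3 3"
  shows "det A = A $$ (0,0) * (A $$ (1,1) * A $$ (2,2) - A $$ (1,2) * A $$ (2,1))
    - A $$ (0,1) * (A $$ (1,0) * A $$ (2,2) - A $$ (1,2) * A $$ (2,0))
    + A $$ (0,2) * (A $$ (1,0) * A $$ (2,1) - A $$ (1,1) * A $$ (2,0))"
proof -
  have det2: "det M = M $$ (0,0) * M $$ (1,1) - M $$ (0,1) * M $$ (1,0)"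
    if M: "M \<in> carrier_mat 2 2" for M :: "'a mat"
  proof -
    have "mat_delete M 0 0 \<in> carrier_mat 1 1" "mat_delete M 0 1 \<in> carrier_mat 1 1"
      using M by (auto simp: mat_delete_def)
    then show ?thesis
      using laplace_expansion_row[OF M, of 0] M
      by (simp add: cofactor_def det_single numeral_2_eq_2 mat_delete_def)
  qed
  have *: "mat_delete A 0 j \<in> carrier_mat 2 2" for j
    using A by (auto simp: mat_delete_def)
  show ?thesis
    using laplace_expansion_row[OF A, of 0] A
    by (simp add: cofactor_def det2[OF *] lessThan_nat_numeral lessThan_Suc numeral_2_eq_2 numeral_3_eq_3)
      (simp add: mat_delete_def algebra_simps)
qed

lemma c1_carrier: "A \<in> carrier_mat 3 3 \<Longrightarrow> c1 A \<in> carrier_mat 3 3"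
  unfolding c1_def by (rule minus_carrier_mat) simp

lemma c1_index:
  assumes "A \<in> carrier_mat 3 3" "i < 3" "j < 3"
  shows "c1 A $$ (i,j) = A $$ (i,j) - (if i = j then (A $$ (0,0) + A $$ (1,1) + A $$ (2,2)) / 3 else 0)"
  using assms by (simp add: c1_def tr_3)

text \<open>The scalar part is chosen so that the trace is \<open>t\<close>.\<close>

definition rk1 :: "complex \<Rightarrow> (nat \<Rightarrow> complex) \<Rightarrow> (nat \<Rightarrow> complex) \<Rightarrow> complex mat" where
  "rk1 t v w = mat 3 3 (\<lambda>(i,j). v i * w j +
     (if i = j then (t - (v 0 * w 0 + v 1 * w 1 + v 2 * w 2)) / 3 else 0))"

lemma rk1_carrier [simp]: "rk1 t v w \<in> carrier_mat 3 3"
  by (simp add: rk1_def)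

lemma dim_rk1 [simp]: "dim_row (rk1 t v w) = 3" "dim_col (rk1 t v w) = 3"
  by (simp_all add: rk1_def)

lemma rk1_index:
  "i < 3 \<Longrightarrow> j < 3 \<Longrightarrow> rk1 t v w $$ (i,j) = v i * w j +
     (if i = j then (t - (v 0 * w 0 + v 1 * w 1 + v 2 * w 2)) / 3 else 0)"
  by (simp add: rk1_def)

lemma tr_rk1: "tr (rk1 t v w) = t"
  by (simp add: tr_3 rk1_index field_simps)

lemma c1_rk1: "c1 (rk1 t v w) = rk1 0 v w"
  by (rule eq_matI) (auto simp: c1_def tr_rk1 rk1_index diff_divide_distrib add_divide_distrib)

text \<open>Put \<open>C = v w^T - z I\<close>, where \<open>v . w = 3 z\<close>. Then
  \<open>C^2 = z v w^T + z^2 I\<close> has trace \<open>6 z^2\<close>, and \<open>C\<close> has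
  eigenvalues \<open>2 z, -z, -z\<close>, hence determinant \<open>2 z^3\<close>; this accounts for
  the factors \<open>1/6\<close> and \<open>1/2\<close> in \<open>d2\<close> and
  \<open>d3\<close>.\<close>

lemma covariants_rk1:
  fixes v w :: "nat \<Rightarrow> complex"
  defines "z \<equiv> (v 0 * w 0 + v 1 * w 1 + v 2 * w 2) / 3"
  shows "d1 (rk1 t v w) = t" "d2 (rk1 t v w) = z ^ 2" "d3 (rk1 t v w) = z ^ 3"
    "c1U (rk1 t v w) = v 2 * w 0" "c2U (rk1 t v w) = z * (v 2 * w 0)"
proof -
  show "d1 (rk1 t v w) = t" by (simp add: d1_def tr_rk1)
  have idx: "rk1 0 v w $$ (i,j) = v i * w j - (if i = j then z else 0)" if "i < 3" "j < 3" for i j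
    using that by (simp add: rk1_index z_def add_divide_distrib diff_divide_distrib)
  have z: "v 0 * w 0 = 3 * z - v 1 * w 1 - v 2 * w 2" by (simp add: z_def field_simps)
  have sq: "(rk1 0 v w * rk1 0 v w) $$ (i,j) = z * (v i * w j) + (if i = j then z ^ 2 else 0)"
    if "i < 3" "j < 3" for i j
  proof -
    have "(rk1 0 v w * rk1 0 v w) $$ (i,j)
      = v i * w j * (v 0 * w 0 + v 1 * w 1 + v 2 * w 2) - 2 * z * (v i * w j) + (if i = j then z ^ 2 else 0)"
      unfolding mult_mat_3[OF rk1_carrier rk1_carrier that]
      using that by (auto simp: idx less_3_iff algebra_simps power2_eq_square)
    then show ?thesis by (simp add: z algebra_simps)
  qed
  have "d2 (rk1 t v w) = (z * (v 0 * w 0 + v 1 * w 1 + v 2 * w 2) + 3 * z ^ 2) / 6"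
    by (simp add: d2_def c1_rk1 tr_3[OF mult_carrier_mat[OF rk1_carrier rk1_carrier]] sq algebra_simps
        del: index_mult_mat)
  then show "d2 (rk1 t v w) = z ^ 2"
    by (simp add: z power2_eq_square)
  have "det (rk1 0 v w) = (v 0 * w 0 + v 1 * w 1 + v 2 * w 2) * z ^ 2 - z ^ 3"
    by (subst det_3) (simp_all add: idx algebra_simps power2_eq_square power3_eq_cube)
  then show "d3 (rk1 t v w) = z ^ 3"
    by (simp add: d3_def c1_rk1 z power2_eq_square power3_eq_cube)
  show "c1U (rk1 t v w) = v 2 * w 0"
    by (simp add: c1U_def rk1_index)
  show "c2U (rk1 t v w) = z * (v 2 * w 0)"
    by (simp add: c2U_def c1_rk1 sq del: index_mult_mat)
qed

section \<open>Degree at most two means scalar plus rank at most one\<close>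

lemma rank_one_of_minors_0:
  fixes C :: "nat \<Rightarrow> nat \<Rightarrow> 'a :: field"
  assumes "\<And>i i' j j'. i < n \<Longrightarrow> i' < n \<Longrightarrow> j < n \<Longrightarrow> j' < n \<Longrightarrow> C i j * C i' j' = C i j' * C i' j"
  shows "\<exists>v w. \<forall>i<n. \<forall>j<n. C i j = v i * w j"
proof (cases "\<exists>a<n. \<exists>b<n. C a b \<noteq> 0")
  case True
  then obtain a b where ab: "a < n" "b < n" "C a b \<noteq> 0" by blast
  \<comment> \<open>With a nonzero pivot \<open>C a b\<close>, column \<open>b\<close> and row
    \<open>a\<close> determine all other entries.\<close>
  have "C i j = C i b * (C a j / C a b)" if "i < n" "j < n" for i j
    using assms[OF that(1) ab(1) that(2) ab(2)] ab(3) by (simp add: field_simps)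
  then show ?thesis
    by (intro exI[of _ "\<lambda>i. C i b", OF exI[of _ "\<lambda>j. C a j / C a b"]]) blast
next
  case False
  then show ?thesis by (intro exI[of _ "\<lambda>_. 0"]) auto
qed

text \<open>Two independent columns of \<open>C\<close> force every row of \<open>B\<close> to be a multiple of their cross product.\<close>

lemma rank_one_of_mult_0:
  fixes B C :: "nat \<Rightarrow> nat \<Rightarrow> 'a :: field"
  assumes BC: "\<And>i j. i < 3 \<Longrightarrow> j < 3 \<Longrightarrow> B i 0 * C 0 j + B i 1 * C 1 j + B i 2 * C 2 j = 0"
  shows "(\<exists>v w. \<forall>i<3. \<forall>j<3. B i j = v i * w j) \<or> (\<exists>v w. \<forall>i<3. \<forall>j<3. C i j = v i * w j)"
proof (cases "\<exists>i<3. \<exists>i'<3. \<exists>j<3. \<exists>j'<3. C i j * C i' j' \<noteq> C i j' * C i' j")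
  case True
  then obtain a a' b b' where ab: "a < 3" "a' < 3" "b < 3" "b' < 3" "C a b * C a' b' \<noteq> C a b' * C a' b"
    by blast
  define n where "n k = (if k = 0 then C 1 b * C 2 b' - C 2 b * C 1 b'
    else if k = 1 then C 2 b * C 0 b' - C 0 b * C 2 b' else C 0 b * C 1 b' - C 1 b * C 0 b')" for k :: nat
  \<comment> \<open>Up to sign the components of \<open>n\<close> are the three minors of the
    columns \<open>b\<close> and \<open>b'\<close>, and one of these minors is nonzero.\<close>
  have "n 0 \<noteq> 0 \<or> n 1 \<noteq> 0 \<or> n 2 \<noteq> 0"
  proof (rule ccontr)
    assume "\<not> ?thesis"
    then have "C 1 b * C 2 b' = C 2 b * C 1 b'" "C 2 b * C 0 b' = C 0 b * C 2 b'"
      "C 0 b * C 1 b' = C 1 b * C 0 b'"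
      by (auto simp: n_def)
    with ab(1,2,5) show False by (auto simp: less_3_iff mult.commute)
  qed
  then obtain k where k: "k < 3" "n k \<noteq> 0" by (auto simp: less_3_iff)
  have "B i j * n l = B i l * n j" if "i < 3" "j < 3" "l < 3" for i j l
  proof -
    note h = BC[OF that(1) ab(3)] BC[OF that(1) ab(4)]
    let ?c = "B i 0 * C 0 b + B i 1 * C 1 b + B i 2 * C 2 b"
    let ?d = "B i 0 * C 0 b' + B i 1 * C 1 b' + B i 2 * C 2 b'"
    \<comment> \<open>Each minor formed from row \<open>i\<close> of \<open>B\<close> and
      \<open>n\<close> is a combination of \<open>?c\<close> and \<open>?d\<close>, the products of
      that row with the columns \<open>b\<close> and \<open>b'\<close>, which vanish.\<close>
    have "B i 0 * n 1 - B i 1 * n 0 = C 2 b * ?d - C 2 b' * ?c"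
      "B i 0 * n 2 - B i 2 * n 0 = C 1 b' * ?c - C 1 b * ?d"
      "B i 1 * n 2 - B i 2 * n 1 = C 0 b * ?d - C 0 b' * ?c"
      by (simp_all add: n_def algebra_simps)
    then have "B i 0 * n 1 = B i 1 * n 0" "B i 0 * n 2 = B i 2 * n 0" "B i 1 * n 2 = B i 2 * n 1"
      unfolding h by simp_all
    with that(2,3) show ?thesis by (auto simp: less_3_iff)
  qed
  from this[OF _ _ k(1)] have "B i j = B i k / n k * n j" if "i < 3" "j < 3" for i j
    using that k(2) by (simp add: field_simps)
  then show ?thesis by (intro disjI1 exI[of _ "\<lambda>i. B i k / n k", OF exI[of _ n]]) blast
next
  case False
  then have "\<exists>v w. \<forall>i<3. \<forall>j<3. C i j = v i * w j"
    by (intro rank_one_of_minors_0) blast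
  then show ?thesis by blast
qed

lemma one_smult_mat: "(1 :: 'a :: semiring_1) \<cdot>\<^sub>m A = A"
  by (rule eq_matI) auto

lemma mat_poly_eval_monic_quadratic:
  assumes A: "A \<in> carrier_mat 3 3"
  shows "mat_poly_eval [:a, b, 1:] A = 0\<^sub>m 3 3 \<longleftrightarrow>
    (\<forall>i<3. \<forall>j<3. (A * A) $$ (i,j) + b * A $$ (i,j) + (if i = j then a else 0) = 0)"
proof -
  have "mat_poly_eval [:a, b, 1:] A = a \<cdot>\<^sub>m 1\<^sub>m 3 + A * (b \<cdot>\<^sub>m 1\<^sub>m 3 + A)"
    using A by (simp add: mat_poly_eval_def cCons_def one_smult_mat)
  moreover have "(a \<cdot>\<^sub>m 1\<^sub>m 3 + A * (b \<cdot>\<^sub>m 1\<^sub>m 3 + A)) $$ (i,j)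
    = (A * A) $$ (i,j) + b * A $$ (i,j) + (if i = j then a else 0)" if "i < 3" "j < 3" for i j
  proof -
    have "(a \<cdot>\<^sub>m 1\<^sub>m 3 + A * (b \<cdot>\<^sub>m 1\<^sub>m 3 + A)) $$ (i,j)
      = (A * (b \<cdot>\<^sub>m 1\<^sub>m 3 + A)) $$ (i,j) + (if i = j then a else 0)"
      using A that by simp
    also have "(A * (b \<cdot>\<^sub>m 1\<^sub>m 3 + A)) $$ (i,j) = (A * A) $$ (i,j) + b * A $$ (i,j)"
      using A that by (subst (1 2) mult_mat_3) (auto simp: less_3_iff algebra_simps)
    finally show ?thesis .
  qed
  ultimately show ?thesis
    using A by (simp add: mat_eq_iff)
qed

text \<open>This guarantees that the minimum in \<open>minpoly_degree\<close> is taken over a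
  nonempty set, so a monic annihilating polynomial of that degree exists.\<close>

lemma Cayley_Hamilton_3:
  assumes A: "A \<in> carrier_mat 3 3"
  shows "\<exists>p. lead_coeff p = 1 \<and> mat_poly_eval p A = 0\<^sub>m 3 3"
proof -
  define e where "e = A $$ (0,0) * A $$ (1,1) - A $$ (0,1) * A $$ (1,0)
    + A $$ (0,0) * A $$ (2,2) - A $$ (0,2) * A $$ (2,0)
    + A $$ (1,1) * A $$ (2,2) - A $$ (1,2) * A $$ (2,1)"
  let ?p = "[: - det A, e, - tr A, 1 :]"
  have "mat_poly_eval ?p A = - det A \<cdot>\<^sub>m 1\<^sub>m 3 + A * (e \<cdot>\<^sub>m 1\<^sub>m 3 + A * (- tr A \<cdot>\<^sub>m 1\<^sub>m 3 + A))"
    using A by (simp add: mat_poly_eval_def cCons_def one_smult_mat)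
  also have "\<dots> = 0\<^sub>m 3 3"
  proof (rule eq_matI)
    fix i j assume "i < dim_row (0\<^sub>m 3 3 :: complex mat)" "j < dim_col (0\<^sub>m 3 3 :: complex mat)"
    then have ij: "i < 3" "j < 3" by auto
    define P where "P = - tr A \<cdot>\<^sub>m 1\<^sub>m 3 + A"
    define Q where "Q = e \<cdot>\<^sub>m 1\<^sub>m 3 + A * P"
    have P: "P \<in> carrier_mat 3 3" "Q \<in> carrier_mat 3 3" using A by (auto simp: P_def Q_def)
    have P_idx: "P $$ (k,l) = A $$ (k,l) - (if k = l then tr A else 0)" if "k < 3" "l < 3" for k l
      using that A by (simp add: P_def)
    have Q_idx: "Q $$ (k,l) = A $$ (k,0) * P $$ (0,l) + A $$ (k,1) * P $$ (1,l) + A $$ (k,2) * P $$ (2,l)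
      + (if k = l then e else 0)" if "k < 3" "l < 3" for k l
      using that A P(1) unfolding Q_def mult_mat_3[OF A P(1) that, symmetric] by simp
    \<comment> \<open>In the Horner form of the characteristic polynomial, the inner factor
      \<open>Q\<close> is the adjugate of \<open>A\<close>, and therefore \<open>A * Q\<close> is
      \<open>det A\<close> times the identity.\<close>
    have adj: "Q $$ (0,0) = A $$ (1,1) * A $$ (2,2) - A $$ (1,2) * A $$ (2,1)"
      "Q $$ (0,1) = A $$ (0,2) * A $$ (2,1) - A $$ (0,1) * A $$ (2,2)"
      "Q $$ (0,2) = A $$ (0,1) * A $$ (1,2) - A $$ (0,2) * A $$ (1,1)"
      "Q $$ (1,0) = A $$ (1,2) * A $$ (2,0) - A $$ (1,0) * A $$ (2,2)"
      "Q $$ (1,1) = A $$ (0,0) * A $$ (2,2) - A $$ (0,2) * A $$ (2,0)"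
      "Q $$ (1,2) = A $$ (0,2) * A $$ (1,0) - A $$ (0,0) * A $$ (1,2)"
      "Q $$ (2,0) = A $$ (1,0) * A $$ (2,1) - A $$ (1,1) * A $$ (2,0)"
      "Q $$ (2,1) = A $$ (0,1) * A $$ (2,0) - A $$ (0,0) * A $$ (2,1)"
      "Q $$ (2,2) = A $$ (0,0) * A $$ (1,1) - A $$ (0,1) * A $$ (1,0)"
      by (simp_all add: Q_idx P_idx tr_3[OF A] e_def algebra_simps)
    have "(- det A \<cdot>\<^sub>m 1\<^sub>m 3 + A * Q) $$ (i,j) = (A * Q) $$ (i,j) - (if i = j then det A else 0)"
      using ij A P by simp
    also have "\<dots> = 0"
      using ij unfolding mult_mat_3[OF A P(2) ij] det_3[OF A] less_3_iff
      by (elim disjE) (simp_all add: adj[unfolded One_nat_def] algebra_simps)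
    finally show "(- det A \<cdot>\<^sub>m 1\<^sub>m 3 + A * (e \<cdot>\<^sub>m 1\<^sub>m 3 + A * (- tr A \<cdot>\<^sub>m 1\<^sub>m 3 + A))) $$ (i,j)
      = 0\<^sub>m 3 3 $$ (i,j)"
      using ij by (simp add: P_def Q_def)
  qed (use A in auto)
  finally have "mat_poly_eval ?p A = 0\<^sub>m 3 3" .
  then show ?thesis by (intro exI[of _ ?p]) simp
qed

text \<open>A monic quadratic annihilator factors over the complex numbers, so
  \<open>(A - r)(A - s) = 0\<close> and one factor has rank at most one. Degree one gives a scalar
  matrix, and degree zero is impossible. Conversely, \<open>v w^T\<close> squares to a multiple of
  itself.\<close>

lemma M1_iff_rk1: "A \<in> M1 \<longleftrightarrow> (\<exists>t v w. A = rk1 t v w)"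
proof
  assume "A \<in> M1"
  then have A: "A \<in> carrier_mat 3 3" and deg: "minpoly_degree A \<le> 2"
    by (auto simp: M1_def)
  let ?P = "\<lambda>n. \<exists>p. lead_coeff p = 1 \<and> degree p = n \<and> mat_poly_eval p A = 0\<^sub>m 3 3"
  have "\<exists>n. ?P n" using Cayley_Hamilton_3[OF A] by blast
  then have "?P (LEAST n. ?P n)" by (rule LeastI_ex)
  then have "?P (minpoly_degree A)"
    unfolding minpoly_degree_def using A by simp
  then obtain p where p: "lead_coeff p = 1" "degree p \<le> 2" "mat_poly_eval p A = 0\<^sub>m 3 3"
    using deg by metis
  have coeffs_p: "coeffs p = map (coeff p) [0..<Suc (degree p)]"
    using p(1) by (auto simp: coeffs_def)
  have rk1: "\<exists>t v w. A = rk1 t v w"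
    if "\<And>i j. i < 3 \<Longrightarrow> j < 3 \<Longrightarrow> A $$ (i,j) = v i * w j + (if i = j then c else 0)" for v w c
  proof -
    \<comment> \<open>\<open>rk1\<close> is indexed by the trace, so the scalar part
      \<open>c\<close> has to be converted into the trace of the whole matrix.\<close>
    have "A = rk1 (3 * c + (v 0 * w 0 + v 1 * w 1 + v 2 * w 2)) v w"
      using A that by (auto simp: rk1_def mat_eq_iff)
    then show ?thesis by blast
  qed
  consider "degree p = 0" | "degree p = 1" | "degree p = 2" using p(2) by linarith
  then show "\<exists>t v w. A = rk1 t v w"
  proof cases
    case 1
    then have "mat_poly_eval p A = 1\<^sub>m 3"
      using p(1) A unfolding mat_poly_eval_def coeffs_p by (simp add: one_smult_mat)
    with p(3) have "(1\<^sub>m 3 :: complex mat) $$ (0,0) = 0\<^sub>m 3 3 $$ (0,0)" by metis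
    then show ?thesis by simp
  next
    case 2
    then have "mat_poly_eval p A = coeff p 0 \<cdot>\<^sub>m 1\<^sub>m 3 + A"
      using p(1) A unfolding mat_poly_eval_def coeffs_p by (simp add: one_smult_mat)
    with p(3) have *: "(coeff p 0 \<cdot>\<^sub>m 1\<^sub>m 3 + A) $$ (i,j) = 0" if "i < 3" "j < 3" for i j
      using that by simp
    have "A $$ (i,j) = 0 * 0 + (if i = j then - coeff p 0 else 0)" if "i < 3" "j < 3" for i j
      using *[OF that] that A by (cases "i = j") (auto simp: add_eq_0_iff)
    then show ?thesis by (rule rk1)
  next
    case 3
    then have "p = [:coeff p 0, coeff p 1, 1:]"
      using p(1) by (intro poly_eqI) (auto simp: coeff_pCons numeral_2_eq_2 coeff_eq_0 split: nat.split)
    with p(3) obtain a b where "mat_poly_eval [:a, b, 1:] A = 0\<^sub>m 3 3" by metis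
    then have q: "(A * A) $$ (i,j) + b * A $$ (i,j) + (if i = j then a else 0) = 0" if "i < 3" "j < 3" for i j
      using that mat_poly_eval_monic_quadratic[OF A] by blast
    \<comment> \<open>The two roots of \<open>X^2 + b X + a\<close>.\<close>
    define r s where "r = (- b + csqrt (b ^ 2 - 4 * a)) / 2" and "s = (- b - csqrt (b ^ 2 - 4 * a)) / 2"
    have rs: "b = - (r + s)" "a = r * s"
      by (simp_all add: r_def s_def field_simps flip: power2_eq_square)
    define B C where "B i j = A $$ (i,j) - (if i = j then r else 0)"
      and "C i j = A $$ (i,j) - (if i = j then s else 0)" for i j
    have "B i 0 * C 0 j + B i 1 * C 1 j + B i 2 * C 2 j = 0" if "i < 3" "j < 3" for i j
    proof -
      have "B i 0 * C 0 j + B i 1 * C 1 j + B i 2 * C 2 j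
        = (A * A) $$ (i,j) + b * A $$ (i,j) + (if i = j then a else 0)"
        unfolding mult_mat_3[OF A A that] rs
        using that by (auto simp: B_def C_def less_3_iff algebra_simps)
      then show ?thesis using q[OF that] by simp
    qed
    then have "(\<exists>v w. \<forall>i<3. \<forall>j<3. B i j = v i * w j) \<or> (\<exists>v w. \<forall>i<3. \<forall>j<3. C i j = v i * w j)"
      by (rule rank_one_of_mult_0)
    then show ?thesis
    proof (elim disjE exE)
      fix v w assume "\<forall>i<3. \<forall>j<3. B i j = v i * w j"
      then show ?thesis by (intro rk1[of v w r]) (auto simp: B_def diff_eq_eq)
    next
      fix v w assume "\<forall>i<3. \<forall>j<3. C i j = v i * w j"
      then show ?thesis by (intro rk1[of v w s]) (auto simp: C_def diff_eq_eq)
    qed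
  qed
next
  assume "\<exists>t v w. A = rk1 t v w"
  then obtain t v w where A: "A = rk1 t v w" by blast
  define y where "y = v 0 * w 0 + v 1 * w 1 + v 2 * w 2"
  define m where "m = (t - y) / 3"
  have y: "v 0 * w 0 = y - v 1 * w 1 - v 2 * w 2" by (simp add: y_def)
  have idx: "A $$ (i,j) = v i * w j + (if i = j then m else 0)" if "i < 3" "j < 3" for i j
    using that by (simp add: A rk1_index m_def y_def)
  have C: "A \<in> carrier_mat 3 3" by (simp add: A)
  \<comment> \<open>With \<open>m\<close> the scalar part and \<open>y = v . w\<close>, the
    annihilator is \<open>(X - m)(X - (m + y))\<close>.\<close>
  have "(A * A) $$ (i,j) + (- (2 * m + y)) * A $$ (i,j) + (if i = j then m * (m + y) else 0) = 0"
    if "i < 3" "j < 3" for i j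
  proof -
    have "(A * A) $$ (i,j) = v i * w j * (v 0 * w 0 + v 1 * w 1 + v 2 * w 2)
        + 2 * m * (v i * w j) + (if i = j then m * m else 0)"
      unfolding mult_mat_3[OF C C that] using that by (auto simp: idx less_3_iff algebra_simps)
    then show ?thesis using that by (simp add: idx y algebra_simps)
  qed
  then have "mat_poly_eval [:m * (m + y), - (2 * m + y), 1:] A = 0\<^sub>m 3 3"
    using mat_poly_eval_monic_quadratic[OF C] by blast
  then have "minpoly_degree A \<le> 2"
    unfolding minpoly_degree_def using C
    by (intro Least_le exI[of _ "[:m * (m + y), - (2 * m + y), 1:]"]) auto
  then show "A \<in> M1" using C by (simp add: M1_def)
qed

lemma N1_iff_rk1: "A \<in> N1 \<longleftrightarrow> (\<exists>v w. A = rk1 0 v w)"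
proof -
  have "A \<in> N1 \<longleftrightarrow> (\<exists>t v w. A = rk1 t v w \<and> tr A = 0)"
    by (auto simp: N1_def M1_iff_rk1)
  also have "\<dots> \<longleftrightarrow> (\<exists>v w. A = rk1 0 v w)" by (metis tr_rk1)
  finally show ?thesis .
qed

section \<open>Conjugation in terms of the parameters\<close>

lemma conj_dot:
  assumes h: "h \<in> carrier_mat 3 3" and g: "g \<in> carrier_mat 3 3" and hg: "h * g = 1\<^sub>m 3"
    and v': "v' = (\<lambda>i. h $$ (i,0) * v 0 + h $$ (i,1) * v 1 + h $$ (i,2) * v 2)"
    and w': "w' = (\<lambda>j. w 0 * g $$ (0,j) + w 1 * g $$ (1,j) + w 2 * g $$ (2,j))"
  shows "v' 0 * w' 0 + v' 1 * w' 1 + v' 2 * w' 2 = v 0 * w 0 + v 1 * w 1 + v 2 * (w 2 :: complex)"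
proof -
  let ?E = "\<lambda>i j. g $$ (i,0) * h $$ (0,j) + g $$ (i,1) * h $$ (1,j) + g $$ (i,2) * h $$ (2,j)"
  have "g * h = 1\<^sub>m 3" using mat_mult_left_right_inverse[OF h g hg] .
  then have gh: "?E i j = (if i = j then 1 else 0)" if "i < 3" "j < 3" for i j
    using mult_mat_3[OF g h that] that by simp
  have "v' 0 * w' 0 + v' 1 * w' 1 + v' 2 * w' 2
    = w 0 * (?E 0 0 * v 0 + ?E 0 1 * v 1 + ?E 0 2 * v 2) + w 1 * (?E 1 0 * v 0 + ?E 1 1 * v 1 + ?E 1 2 * v 2)
      + w 2 * (?E 2 0 * v 0 + ?E 2 1 * v 1 + ?E 2 2 * v 2)"
    unfolding v' w' by (simp only: algebra_simps)
  also have "\<dots> = v 0 * w 0 + v 1 * w 1 + v 2 * w 2"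
    by (simp add: gh del: One_nat_def)
  finally show ?thesis .
qed

text \<open>The column \<open>v\<close> goes to \<open>h v\<close> and the row \<open>w^T\<close> to
  \<open>w^T g\<close>. The scalar part survives because \<open>h * g\<close> is the identity and
  \<open>v . w\<close> does not change.\<close>

lemma conj_rk1:
  assumes h: "h \<in> carrier_mat 3 3" and g: "g \<in> carrier_mat 3 3" and hg: "h * g = 1\<^sub>m 3"
  shows "h * rk1 t v w * g = rk1 t
    (\<lambda>i. h $$ (i,0) * v 0 + h $$ (i,1) * v 1 + h $$ (i,2) * v 2)
    (\<lambda>j. w 0 * g $$ (0,j) + w 1 * g $$ (1,j) + w 2 * g $$ (2,j))" (is "_ = rk1 t ?v ?w")
proof -
  have hg': "h $$ (i,0) * g $$ (0,j) + h $$ (i,1) * g $$ (1,j) + h $$ (i,2) * g $$ (2,j)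
      = (if i = j then 1 else 0)" if "i < 3" "j < 3" for i j
    using mult_mat_3[OF h g that] that hg by simp
  have dot: "?v 0 * ?w 0 + ?v 1 * ?w 1 + ?v 2 * ?w 2 = v 0 * w 0 + v 1 * w 1 + v 2 * w 2"
    by (rule conj_dot[OF h g hg refl refl])
  define m where "m = (t - (v 0 * w 0 + v 1 * w 1 + v 2 * w 2)) / 3"
  show ?thesis
  proof (rule eq_matI)
    fix i j assume "i < dim_row (rk1 t ?v ?w)" "j < dim_col (rk1 t ?v ?w)"
    then have ij: "i < 3" "j < 3" by (auto simp: rk1_def)
    have idx: "rk1 t v w $$ (k,l) = v k * w l + (if k = l then m else 0)" if "k < 3" "l < 3" for k l
      using that by (simp add: rk1_index m_def)
    have "(h * rk1 t v w * g) $$ (i,j) = ?v i * ?w j + m *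
      (h $$ (i,0) * g $$ (0,j) + h $$ (i,1) * g $$ (1,j) + h $$ (i,2) * g $$ (2,j))"
      unfolding mult_mat_3[OF mult_carrier_mat[OF h rk1_carrier] g ij]
      using ij by (simp add: mult_mat_3[OF h rk1_carrier] idx del: index_mult_mat) (simp only: algebra_simps)
    also have "\<dots> = ?v i * ?w j + (if i = j then m else 0)"
      by (subst hg'[OF ij]) simp
    also have "\<dots> = rk1 t ?v ?w $$ (i,j)"
      unfolding rk1_index[OF ij] dot m_def ..
    finally show "(h * rk1 t v w * g) $$ (i,j) = rk1 t ?v ?w $$ (i,j)" .
  qed (use h g in \<open>auto simp: rk1_def\<close>)
qed

section \<open>Invariants of the unipotent group\<close>

lemma mat_polyfun_cong:
  "f \<in> mat_polyfun \<Longrightarrow> (\<And>A. A \<in> carrier_mat 3 3 \<Longrightarrow> g A = f A) \<Longrightarrow> g \<in> mat_polyfun"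
  by (auto simp: mat_polyfun_def)

lemma mat_polyfun_const: "(\<lambda>A. c) \<in> mat_polyfun"
  unfolding mat_polyfun_def by (auto intro!: bexI[of _ "\<lambda>x. c"] pf_const)

lemma mat_polyfun_entry: "i < 3 \<Longrightarrow> j < 3 \<Longrightarrow> (\<lambda>A. A $$ (i,j)) \<in> mat_polyfun"
  unfolding mat_polyfun_def by (auto intro!: bexI[of _ "\<lambda>x. x (i,j)"] pf_var)

lemma mat_polyfun_add:
  assumes "f \<in> mat_polyfun" "g \<in> mat_polyfun"
  shows "(\<lambda>A. f A + g A) \<in> mat_polyfun"
proof -
  from assms obtain p q where "p \<in> polyfun ({..<3} \<times> {..<3})" "q \<in> polyfun ({..<3} \<times> {..<3})"
    "\<And>A. A \<in> carrier_mat 3 3 \<Longrightarrow> f A = p (\<lambda>ij. A $$ ij)"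
    "\<And>A. A \<in> carrier_mat 3 3 \<Longrightarrow> g A = q (\<lambda>ij. A $$ ij)"
    by (auto simp: mat_polyfun_def)
  then show ?thesis
    unfolding mat_polyfun_def by (auto intro!: bexI[of _ "\<lambda>x. p x + q x"] pf_add)
qed

lemma mat_polyfun_mult:
  assumes "f \<in> mat_polyfun" "g \<in> mat_polyfun"
  shows "(\<lambda>A. f A * g A) \<in> mat_polyfun"
proof -
  from assms obtain p q where "p \<in> polyfun ({..<3} \<times> {..<3})" "q \<in> polyfun ({..<3} \<times> {..<3})"
    "\<And>A. A \<in> carrier_mat 3 3 \<Longrightarrow> f A = p (\<lambda>ij. A $$ ij)"
    "\<And>A. A \<in> carrier_mat 3 3 \<Longrightarrow> g A = q (\<lambda>ij. A $$ ij)"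
    by (auto simp: mat_polyfun_def)
  then show ?thesis
    unfolding mat_polyfun_def by (auto intro!: bexI[of _ "\<lambda>x. p x * q x"] pf_mult)
qed

lemma mat_polyfun_diff:
  assumes "f \<in> mat_polyfun" "g \<in> mat_polyfun"
  shows "(\<lambda>A. f A - g A) \<in> mat_polyfun"
  using mat_polyfun_add[OF assms(1) mat_polyfun_mult[OF mat_polyfun_const[of "-1"] assms(2)]] by simp

lemma mat_polyfun_compose:
  assumes "p \<in> polyfun I" "\<And>i. i \<in> I \<Longrightarrow> f i \<in> mat_polyfun"
  shows "(\<lambda>A. p (\<lambda>i. f i A)) \<in> mat_polyfun"
  using assms(1)
  by induction (simp_all add: assms(2) mat_polyfun_const mat_polyfun_add mat_polyfun_mult)

lemmas mat_polyfun_intros =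
  mat_polyfun_const mat_polyfun_entry mat_polyfun_add mat_polyfun_mult mat_polyfun_diff

lemma mat_polyfun_c1_entry:
  assumes "i < 3" "j < 3"
  shows "(\<lambda>A. c1 A $$ (i,j)) \<in> mat_polyfun"
proof -
  have "(\<lambda>A. A $$ (i,j) - (if i = j then 1 / 3 else 0) * (A $$ (0,0) + A $$ (1,1) + A $$ (2,2))) \<in> mat_polyfun"
    by (intro mat_polyfun_intros assms) simp_all
  then show ?thesis
    by (rule mat_polyfun_cong) (simp add: c1_index assms)
qed

lemma mat_polyfun_covariants:
  "d1 \<in> mat_polyfun" "d2 \<in> mat_polyfun" "d3 \<in> mat_polyfun" "c1U \<in> mat_polyfun" "c2U \<in> mat_polyfun"
proof -
  have sq: "(\<lambda>A. (c1 A * c1 A) $$ (i,j)) \<in> mat_polyfun" if "i < 3" "j < 3" for i j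
  proof -
    have "(\<lambda>A. c1 A $$ (i,0) * c1 A $$ (0,j) + c1 A $$ (i,1) * c1 A $$ (1,j)
        + c1 A $$ (i,2) * c1 A $$ (2,j)) \<in> mat_polyfun"
      by (intro mat_polyfun_add mat_polyfun_mult mat_polyfun_c1_entry that) simp_all
    then show ?thesis
      by (rule mat_polyfun_cong) (rule mult_mat_3[OF c1_carrier c1_carrier that])
  qed
  show "d1 \<in> mat_polyfun"
    by (rule mat_polyfun_cong[of "\<lambda>A. A $$ (0,0) + A $$ (1,1) + A $$ (2,2)"])
      (auto intro!: mat_polyfun_intros simp: d1_def tr_3)
  have "(\<lambda>A. (1 / 6) * ((c1 A * c1 A) $$ (0,0) + (c1 A * c1 A) $$ (1,1) + (c1 A * c1 A) $$ (2,2))) \<in> mat_polyfun"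
    by (intro mat_polyfun_intros sq) simp_all
  then show "d2 \<in> mat_polyfun"
    by (rule mat_polyfun_cong)
      (simp add: d2_def tr_3[OF mult_carrier_mat[OF c1_carrier c1_carrier]] del: index_mult_mat)
  have "(\<lambda>A. (1 / 2) * (c1 A $$ (0,0) * (c1 A $$ (1,1) * c1 A $$ (2,2) - c1 A $$ (1,2) * c1 A $$ (2,1))
    - c1 A $$ (0,1) * (c1 A $$ (1,0) * c1 A $$ (2,2) - c1 A $$ (1,2) * c1 A $$ (2,0))
    + c1 A $$ (0,2) * (c1 A $$ (1,0) * c1 A $$ (2,1) - c1 A $$ (1,1) * c1 A $$ (2,0)))) \<in> mat_polyfun"
    by (intro mat_polyfun_const mat_polyfun_add mat_polyfun_mult mat_polyfun_diff mat_polyfun_c1_entry) simp_all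
  then show "d3 \<in> mat_polyfun"
    by (rule mat_polyfun_cong) (simp add: d3_def det_3[OF c1_carrier])
  show "c1U \<in> mat_polyfun"
    unfolding c1U_def by (rule mat_polyfun_entry) simp_all
  show "c2U \<in> mat_polyfun"
    unfolding c2U_def by (rule sq) simp_all
qed

lemma mat_polyfun_comp_c1:
  assumes "f \<in> mat_polyfun"
  shows "(\<lambda>A. f (c1 A)) \<in> mat_polyfun"
proof -
  obtain p where p: "p \<in> polyfun ({..<3} \<times> {..<3})"
    "\<And>A. A \<in> carrier_mat 3 3 \<Longrightarrow> f A = p (\<lambda>ij. A $$ ij)"
    using assms by (auto simp: mat_polyfun_def)
  have "(\<lambda>A. p (\<lambda>ij. c1 A $$ ij)) \<in> mat_polyfun"
    by (rule mat_polyfun_compose[OF p(1)]) (auto intro: mat_polyfun_c1_entry)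
  then show ?thesis by (rule mat_polyfun_cong) (simp add: p(2) c1_carrier)
qed

lemma conj_cancel:
  fixes h g A :: "complex mat"
  assumes h: "h \<in> carrier_mat 3 3" and g: "g \<in> carrier_mat 3 3" and hg: "h * g = 1\<^sub>m 3"
    and A: "A \<in> carrier_mat 3 3"
  shows "g * (h * A * g) * h = A"
proof -
  have gh: "g * h = 1\<^sub>m 3" using mat_mult_left_right_inverse[OF h g hg] .
  have Ag: "A * g \<in> carrier_mat 3 3" using A g by simp
  have "g * (h * A * g) = g * h * (A * g)"
    by (simp only: assoc_mult_mat[OF h A g] assoc_mult_mat[OF g h Ag])
  also have "\<dots> = A * g" by (simp only: gh left_mult_one_mat[OF Ag])
  finally show ?thesis by (simp only: assoc_mult_mat[OF A g h] gh right_mult_one_mat[OF A])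
qed

text \<open>Both directions matter: \<open>U_invariants\<close> demands invariance at every matrix,
  also off the subset, where a restricted function is \<open>0\<close>. The same applies to
  \<open>N1\<close>.\<close>

lemma M1_conj_iff:
  assumes h: "h \<in> carrier_mat 3 3" and g: "g \<in> carrier_mat 3 3" and hg: "h * g = 1\<^sub>m 3"
    and A: "A \<in> carrier_mat 3 3"
  shows "h * A * g \<in> M1 \<longleftrightarrow> A \<in> M1"
proof -
  have conj: "h * A * g \<in> M1"
    if "A \<in> M1" "h \<in> carrier_mat 3 3" "g \<in> carrier_mat 3 3" "h * g = 1\<^sub>m 3" for h g A
    using that(1) conj_rk1[OF that(2-4)] unfolding M1_iff_rk1 by blast
  have "A \<in> M1" if "h * A * g \<in> M1"
    using conj[OF that g h mat_mult_left_right_inverse[OF h g hg]] conj_cancel[OF assms] by simp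
  with conj[OF _ h g hg] show ?thesis by blast
qed

lemma N1_conj_iff:
  assumes h: "h \<in> carrier_mat 3 3" and g: "g \<in> carrier_mat 3 3" and hg: "h * g = 1\<^sub>m 3"
    and A: "A \<in> carrier_mat 3 3"
  shows "h * A * g \<in> N1 \<longleftrightarrow> A \<in> N1"
proof -
  have conj: "h * A * g \<in> N1"
    if "A \<in> N1" "h \<in> carrier_mat 3 3" "g \<in> carrier_mat 3 3" "h * g = 1\<^sub>m 3" for h g A
    using that(1) conj_rk1[OF that(2-4)] unfolding N1_iff_rk1 by blast
  have "A \<in> N1" if "h * A * g \<in> N1"
    using conj[OF that g h mat_mult_left_right_inverse[OF h g hg]] conj_cancel[OF assms] by simp
  with conj[OF _ h g hg] show ?thesis by blast
qed

lemma M1_carrier: "A \<in> M1 \<Longrightarrow> A \<in> carrier_mat 3 3"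
  by (simp add: M1_def)

lemma N1_subset_M1: "N1 \<subseteq> M1"
  by (auto simp: N1_def)

lemma c1_in_N1: "A \<in> M1 \<Longrightarrow> c1 A \<in> N1"
  unfolding M1_iff_rk1 N1_iff_rk1 using c1_rk1 by metis

lemma c1_N1: "A \<in> N1 \<Longrightarrow> c1 A = A"
  unfolding N1_iff_rk1 using c1_rk1 by metis

lemma coord_ring_restr: "f \<in> mat_polyfun \<Longrightarrow> restr S f \<in> coord_ring S"
  by (simp add: coord_ring_def)

lemma U_invariants_outside: "f \<in> U_invariants S \<Longrightarrow> A \<notin> S \<Longrightarrow> f A = 0"
  by (auto simp: U_invariants_def coord_ring_def restr_def)

lemma U_invariantsD:
  "f \<in> U_invariants S \<Longrightarrow> u \<in> U3 \<Longrightarrow> v \<in> carrier_mat 3 3 \<Longrightarrow> v * u = 1\<^sub>m 3 \<Longrightarrow>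
    A \<in> carrier_mat 3 3 \<Longrightarrow> f (v * A * u) = f A"
  by (simp add: U_invariants_def)

text \<open>The images of \<open>x\<^sub>0, \<dots>, x\<^sub>4\<close> at a matrix with parameters \<open>t, z, D\<close>.\<close>

definition pt :: "complex \<Rightarrow> complex \<Rightarrow> complex \<Rightarrow> nat \<Rightarrow> complex" where
  "pt t z D i = (if i = 0 then t else if i = 1 then z ^ 2 else if i = 2 then z ^ 3
     else if i = 3 then D else z * D)"

lemma phi_rk1:
  "phi P (rk1 t v w) = P (pt t ((v 0 * w 0 + v 1 * w 1 + v 2 * w 2) / 3) (v 2 * w 0))"
proof -
  have "rk1 t v w \<in> M1" using M1_iff_rk1 by blast
  then show ?thesis unfolding phi_def restr_def covariants_rk1 pt_def[abs_def] by simp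
qed

lemma phi_outside: "A \<notin> M1 \<Longrightarrow> phi P A = 0"
  by (simp add: phi_def restr_def)

text \<open>The trace and \<open>v . w\<close> are invariant under all conjugations. For
  unitriangular \<open>g\<close>, the last row of \<open>h\<close> and the first column of
  \<open>g\<close> are unit vectors, so \<open>v 2\<close> and \<open>w 0\<close> are also
  fixed.\<close>

lemma phi_in_U_invariants:
  assumes "P \<in> polyfun {..<5}"
  shows "phi P \<in> U_invariants M1"
proof -
  have *: "(\<lambda>A. if i = 0 then d1 A else if i = 1 then d2 A else if i = 2 then d3 A
      else if i = 3 then c1U A else c2U A) \<in> mat_polyfun" for i :: nat
    using mat_polyfun_covariants by (cases "i = 0"; cases "i = 1"; cases "i = 2"; cases "i = 3") simp_all
  have "phi P \<in> coord_ring M1"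
    unfolding phi_def by (intro coord_ring_restr mat_polyfun_compose[OF assms] *)
  moreover have "phi P (h * A * g) = phi P A"
    if g: "g \<in> U3" and h: "h \<in> carrier_mat 3 3" and hg: "h * g = 1\<^sub>m 3" and A: "A \<in> carrier_mat 3 3" for g h A
  proof (cases "A \<in> M1")
    case False
    have "g \<in> carrier_mat 3 3" using g by (simp add: U3_def)
    with False M1_conj_iff[OF h this hg A] show ?thesis by (simp add: phi_outside)
  next
    case True
    then obtain t v w where rk1: "A = rk1 t v w" using M1_iff_rk1 by blast
    have gC: "g \<in> carrier_mat 3 3" using g by (simp add: U3_def)
    have "i < 3 \<Longrightarrow> j < i \<Longrightarrow> g $$ (i,j) = 0" "i < 3 \<Longrightarrow> g $$ (i,i) = 1" for i j
      using g by (simp_all add: U3_def)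
    then have g_idx: "g $$ (0,0) = 1" "g $$ (1,1) = 1" "g $$ (2,2) = 1"
      "g $$ (1,0) = 0" "g $$ (2,0) = 0" "g $$ (2,1) = 0"
      by simp_all
    \<comment> \<open>\<open>h\<close> is only known as the inverse of \<open>g\<close>; its last
      row is solved for from \<open>h * g = 1\<close>, column by column.\<close>
    have row: "h $$ (2,0) * g $$ (0,j) + h $$ (2,1) * g $$ (1,j) + h $$ (2,2) * g $$ (2,j)
        = (if 2 = j then 1 else 0)" if "j < 3" for j
      using mult_mat_3[OF h gC _ that, of 2] that hg by simp
    have "h $$ (2,0) = 0" using row[of 0] g_idx by simp
    moreover from this have "h $$ (2,1) = 0" using row[of 1] g_idx by simp
    ultimately have h_idx: "h $$ (2,0) = 0" "h $$ (2,1) = 0" "h $$ (2,2) = 1" using row[of 2] g_idx by simp_all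
    show ?thesis
      unfolding rk1 conj_rk1[OF h gC hg] phi_rk1 conj_dot[OF h gC hg refl refl]
      unfolding g_idx h_idx by simp
  qed
  ultimately show ?thesis by (simp add: U_invariants_def)
qed

lemma restr_N1_in_U_invariants:
  assumes "f \<in> U_invariants M1"
  shows "restr N1 f \<in> U_invariants N1"
proof -
  obtain p where p: "p \<in> mat_polyfun" "f = restr M1 p"
    using assms by (auto simp: U_invariants_def coord_ring_def)
  have "restr N1 f = restr N1 p"
    using N1_subset_M1 by (force simp: p(2) restr_def)
  then have "restr N1 f \<in> coord_ring N1" using p(1) by (simp add: coord_ring_restr)
  moreover have "restr N1 f (h * A * g) = restr N1 f A"
    if g: "g \<in> U3" and h: "h \<in> carrier_mat 3 3" and hg: "h * g = 1\<^sub>m 3" and A: "A \<in> carrier_mat 3 3" for g h A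
    using N1_conj_iff[OF h _ hg A] U_invariantsD[OF assms that] g by (simp add: restr_def U3_def)
  ultimately show ?thesis by (simp add: U_invariants_def)
qed

text \<open>\<open>c1\<close> maps \<open>M1\<close> into \<open>N1\<close> and commutes with
  conjugation.\<close>

lemma emb_in_U_invariants:
  assumes "f \<in> U_invariants N1"
  shows "emb f \<in> U_invariants M1"
proof -
  obtain p where p: "p \<in> mat_polyfun" "f = restr N1 p"
    using assms by (auto simp: U_invariants_def coord_ring_def)
  have "emb f = restr M1 (\<lambda>A. p (c1 A))"
    by (auto simp: emb_def p(2) restr_def c1_in_N1)
  then have "emb f \<in> coord_ring M1" using p(1) by (simp add: coord_ring_restr mat_polyfun_comp_c1)
  moreover have "emb f (h * A * g) = emb f A"
    if g: "g \<in> U3" and h: "h \<in> carrier_mat 3 3" and hg: "h * g = 1\<^sub>m 3" and A: "A \<in> carrier_mat 3 3" for g h A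
  proof -
    have gC: "g \<in> carrier_mat 3 3" using g by (simp add: U3_def)
    have "f (c1 (h * A * g)) = f (c1 A)" if "A \<in> M1"
    proof -
      obtain t v w where rk1: "A = rk1 t v w" using \<open>A \<in> M1\<close> M1_iff_rk1[of A] by blast
      have "c1 (h * A * g) = h * rk1 0 v w * g"
        unfolding rk1 conj_rk1[OF h gC hg] c1_rk1 ..
      then show ?thesis
        using U_invariantsD[OF assms g h hg rk1_carrier] by (simp add: rk1 c1_rk1)
    qed
    then show ?thesis
      using M1_conj_iff[OF h gC hg A] by (simp add: emb_def restr_def)
  qed
  ultimately show ?thesis by (simp add: U_invariants_def)
qed

section \<open>A normal form for generic matrices and its invariants\<close>

definition slice :: "complex \<Rightarrow> complex \<Rightarrow> complex \<Rightarrow> complex mat" where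
  "slice t z D = rk1 t (\<lambda>i. if i = 2 then 1 else 0) (\<lambda>j. if j = 0 then D else if j = 2 then 3 * z else 0)"

lemma slice_in_M1: "slice t z D \<in> M1"
  unfolding slice_def using M1_iff_rk1 by blast

lemma phi_slice: "phi P (slice t z D) = P (pt t z D)"
  unfolding slice_def phi_rk1 by simp

text \<open>The normal form is lower triangular with entries linear in \<open>t, z, D\<close>, so a
  regular function restricted to it is a polynomial in these three parameters.\<close>

lemma slice_index:
  "i < 3 \<Longrightarrow> j < 3 \<Longrightarrow> slice t z D $$ (i,j) = (if i = j then (if i = 2 then t / 3 + 2 * z else t / 3 - z)
     else if i = 2 \<and> j = 0 then D else 0)"
  by (auto simp: slice_def rk1_index less_3_iff field_simps)

text \<open>As \<open>v 2\<close> and \<open>w 0\<close> are nonzero, a unitriangular matrix can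
  clear \<open>v 0\<close>, \<open>v 1\<close> and \<open>w 1\<close>. What is left depends only on
  \<open>t\<close>, \<open>v . w\<close> and \<open>v 2 * w 0\<close>.\<close>

lemma conj_to_slice:
  assumes "v 2 * w 0 \<noteq> 0"
  obtains g h where "g \<in> U3" "h \<in> carrier_mat 3 3" "h * g = 1\<^sub>m 3"
    "h * rk1 t v w * g = slice t ((v 0 * w 0 + v 1 * w 1 + v 2 * w 2) / 3) (v 2 * w 0)"
proof -
  have nz: "v 2 \<noteq> 0" "w 0 \<noteq> 0" using assms by auto
  \<comment> \<open>The last column of \<open>g\<close> is \<open>v / v 2\<close>, so its inverse
    \<open>h\<close> sends \<open>v\<close> to \<open>v 2\<close> times the last unit vector; the
    entry \<open>(0,1)\<close> cancels \<open>w 1\<close>.\<close>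
  define g where "g = mat 3 3 (\<lambda>(i,j). if i = j then 1 else if i = 0 \<and> j = 1 then - w 1 / w 0
    else if i = 0 \<and> j = 2 then v 0 / v 2 else if i = 1 \<and> j = 2 then v 1 / v 2 else 0)"
  define h where "h = mat 3 3 (\<lambda>(i,j). if i = j then 1 else if i = 0 \<and> j = 1 then w 1 / w 0
    else if i = 0 \<and> j = 2 then - v 0 / v 2 - w 1 * v 1 / (w 0 * v 2)
    else if i = 1 \<and> j = 2 then - v 1 / v 2 else 0)"
  have C: "g \<in> carrier_mat 3 3" "h \<in> carrier_mat 3 3" by (simp_all add: g_def h_def)
  have gU: "g \<in> U3" by (auto simp: U3_def g_def)
  have "(h * g) $$ (i,j) = 1\<^sub>m 3 $$ (i,j)" if "i < 3" "j < 3" for i j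
    unfolding mult_mat_3[OF C(2,1) that] using that nz by (auto simp: less_3_iff g_def h_def field_simps)
  then have hg: "h * g = 1\<^sub>m 3" using C by (intro eq_matI) auto
  define z where "z = (v 0 * w 0 + v 1 * w 1 + v 2 * w 2) / 3"
  let ?v = "\<lambda>i. h $$ (i,0) * v 0 + h $$ (i,1) * v 1 + h $$ (i,2) * v 2"
  let ?w = "\<lambda>j. w 0 * g $$ (0,j) + w 1 * g $$ (1,j) + w 2 * g $$ (2,j)"
  have vw: "?v 0 = 0" "?v 1 = 0" "?v 2 = v 2" "?w 0 = w 0" "?w 1 = 0"
    using nz by (auto simp: g_def h_def field_simps)
  have dot: "?v 0 * ?w 0 + ?v 1 * ?w 1 + ?v 2 * ?w 2 = 3 * z"
    unfolding conj_dot[OF C(2,1) hg refl refl] z_def by simp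
  \<comment> \<open>The last entry of \<open>?w\<close> need not be computed: only its product with
    \<open>v 2\<close> occurs in the matrix, and invariance of the dot product supplies it.\<close>
  then have w2: "v 2 * ?w 2 = 3 * z" unfolding vw by simp
  have "rk1 t ?v ?w $$ (i,j) = slice t z (v 2 * w 0) $$ (i,j)" if "i < 3" "j < 3" for i j
  proof -
    have "rk1 t ?v ?w $$ (i,j) = ?v i * ?w j + (if i = j then (t - 3 * z) / 3 else 0)"
      unfolding rk1_index[OF that] dot ..
    moreover have "i = 0 \<or> i = 1 \<or> i = 2" "j = 0 \<or> j = 1 \<or> j = 2" using that by auto
    ultimately show ?thesis
      unfolding slice_index[OF that]
      by (elim disjE) (simp_all only: vw w2, simp_all add: field_simps)
  qed
  then have "rk1 t ?v ?w = slice t z (v 2 * w 0)"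
    by (intro eq_matI) (auto simp: slice_def)
  then have "h * rk1 t v w * g = slice t z (v 2 * w 0)"
    unfolding conj_rk1[OF C(2,1) hg] .
  with gU C(2) hg show thesis unfolding z_def by (rule that)
qed

lemma isCont_rk1_entry:
  assumes "\<And>i. isCont (\<lambda>s. v s i) a" "\<And>i. isCont (\<lambda>s. w s i) a" "ij \<in> {..<3} \<times> {..<3}"
  shows "isCont (\<lambda>s. rk1 t (v s) (w s) $$ ij) (a :: complex)"
proof -
  obtain i j where ij: "ij = (i,j)" "i < 3" "j < 3" using assms(3) by auto
  show ?thesis unfolding ij(1) rk1_index[OF ij(2,3)]
    by (cases "i = j") (simp_all add: assms(1,2))
qed

text \<open>On the dense set \<open>v 2 * w 0 \<noteq> 0\<close> this is \<open>conj_to_slice\<close>; both sides are continuous.\<close>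

lemma U_invariant_eq_slice:
  assumes F: "F \<in> U_invariants M1"
  shows "F (rk1 t v w) = F (slice t ((v 0 * w 0 + v 1 * w 1 + v 2 * w 2) / 3) (v 2 * w 0))"
proof -
  define z where "z v w = (v 0 * w 0 + v 1 * w 1 + v 2 * w 2) / 3" for v w :: "nat \<Rightarrow> complex"
  have generic: "F (rk1 t v w) = F (slice t (z v w) (v 2 * w 0))" if nz: "v 2 * w 0 \<noteq> 0" for v w
  proof -
    obtain g h where "g \<in> U3" "h \<in> carrier_mat 3 3" "h * g = 1\<^sub>m 3"
      "h * rk1 t v w * g = slice t (z v w) (v 2 * w 0)"
      using conj_to_slice[where v = v and w = w and t = t, OF nz] unfolding z_def by blast
    then show ?thesis using U_invariantsD[OF F, of g h "rk1 t v w"] by simp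
  qed
  obtain p where p: "p \<in> polyfun ({..<3} \<times> {..<3})" "\<And>A. A \<in> M1 \<Longrightarrow> F A = p (\<lambda>ij. A $$ ij)"
    using F by (auto simp: U_invariants_def coord_ring_def mat_polyfun_def restr_def M1_carrier)
  \<comment> \<open>Shifting \<open>v 2\<close> and \<open>w 0\<close> by \<open>s\<close> makes
    both nonzero for all small \<open>s\<close> other than \<open>0\<close>, even when they vanish
    at the start.\<close>
  define v' w' where "v' s i = v i + (if i = 2 then s else 0)"
    and "w' s i = w i + (if i = 0 then s else 0)" for s :: complex and i :: nat
  have cont: "isCont (\<lambda>s. v' s i) 0" "isCont (\<lambda>s. w' s i) 0" for i
    unfolding v'_def w'_def by (cases "i = 2"; cases "i = 0"; simp)+
  have F_M1: "F (rk1 t v w) = p (\<lambda>ij. rk1 t v w $$ ij)" for t v w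
    using p(2) M1_iff_rk1 by blast
  have "isCont (\<lambda>s. F (rk1 t (v' s) (w' s))) 0"
    unfolding F_M1 by (intro polyfun_isCont[OF p(1)] isCont_rk1_entry cont)
  moreover have "isCont (\<lambda>s. F (slice t (z (v' s) (w' s)) (v' s 2 * w' s 0))) 0"
  proof -
    have "isCont (\<lambda>s. if j = 0 then v' s 2 * w' s 0 else if j = 2 then 3 * z (v' s) (w' s) else 0) 0" for j :: nat
      unfolding z_def by (cases "j = 0"; cases "j = 2") (simp_all add: cont)
    then show ?thesis
      unfolding slice_def F_M1 by (intro polyfun_isCont[OF p(1)] isCont_rk1_entry) simp_all
  qed
  moreover have "eventually (\<lambda>s. F (rk1 t (v' s) (w' s)) = F (slice t (z (v' s) (w' s)) (v' s 2 * w' s 0))) (at 0)"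
    using eventually_neq_at_within[of "- v 2" 0 UNIV] eventually_neq_at_within[of "- w 0" 0 UNIV]
  proof eventually_elim
    case (elim s)
    then have "v' s 2 * w' s 0 \<noteq> 0" by (auto simp: v'_def w'_def add_eq_0_iff)
    then show ?case by (rule generic)
  qed
  ultimately have "F (rk1 t (v' 0) (w' 0)) = F (slice t (z (v' 0) (w' 0)) (v' 0 2 * w' 0 0))"
    by (rule isCont_eq_at_limit)
  moreover have "v' 0 = v" "w' 0 = w" by (auto simp: v'_def w'_def)
  ultimately show ?thesis by (simp add: z_def)
qed

text \<open>Permuting the diagonal of \<open>slice t s 0\<close> does not change \<open>F\<close>, and the three resulting
  directions add up to zero.\<close>

lemma U_invariant_slice_derivative:
  assumes F: "F \<in> U_invariants M1"
  shows "((\<lambda>s. F (slice t s 0)) has_field_derivative 0) (at 0)"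
proof -
  let ?I = "{..<3} \<times> {..<3} :: (nat \<times> nat) set"
  obtain p where p: "p \<in> polyfun ?I" "\<And>A. A \<in> M1 \<Longrightarrow> F A = p (\<lambda>ij. A $$ ij)"
    using F by (auto simp: U_invariants_def coord_ring_def mat_polyfun_def restr_def M1_carrier)
  define a :: "nat \<times> nat \<Rightarrow> complex" where "a = (\<lambda>(i,j). if i = j then t / 3 else 0)"
  define d :: "nat \<Rightarrow> nat \<times> nat \<Rightarrow> complex"
    where "d k = (\<lambda>(i,j). if i = j then (if i = k then 2 else - 1) else 0)" for k
  obtain l where l: "\<And>d. ((\<lambda>s. p (\<lambda>i. a i + s * d i)) has_field_derivative (\<Sum>i\<in>?I. l i * d i)) (at 0)"
    using polyfun_directional_derivative[OF p(1)] by blast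
  define L where "L k = (\<Sum>i\<in>?I. l i * d k i)" for k
  have "p (\<lambda>ij. a ij + s * d k ij) = F (slice t s 0)" if "k < 3" for k s
  proof -
    \<comment> \<open>For each \<open>k\<close> these vectors have \<open>v . w = 3 s\<close> and
      \<open>v 2 * w 0 = 0\<close>, so \<open>F\<close> takes the value of the same slice point,
      while the matrix is diagonal with the exceptional entry in place \<open>k\<close>.\<close>
    let ?v = "\<lambda>i. if i = k then 1 else 0" and ?w = "\<lambda>i. if i = k then 3 * s else 0"
    have vw: "?v 0 * ?w 0 + ?v 1 * ?w 1 + ?v 2 * ?w 2 = 3 * s" "?v 2 * ?w 0 = 0"
      using that by (auto simp: less_3_iff)
    have "F (rk1 t ?v ?w) = F (slice t s 0)"
      unfolding U_invariant_eq_slice[OF F] vw by simp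
    moreover have "F (rk1 t ?v ?w) = p (\<lambda>ij. rk1 t ?v ?w $$ ij)"
      using p(2) M1_iff_rk1 by blast
    moreover have "p (\<lambda>ij. rk1 t ?v ?w $$ ij) = p (\<lambda>ij. a ij + s * d k ij)"
    proof (rule polyfun_cong[OF p(1)])
      fix ij assume "ij \<in> ?I"
      then obtain i j where ij: "ij = (i,j)" "i < 3" "j < 3" by auto
      show "rk1 t ?v ?w $$ ij = a ij + s * d k ij"
        unfolding ij(1) rk1_index[OF ij(2,3)] vw(1) by (auto simp: a_def d_def field_simps)
    qed
    ultimately show ?thesis by simp
  qed
  then have der: "((\<lambda>s. F (slice t s 0)) has_field_derivative L k) (at 0)" if "k < 3" for k
    using l[of "d k"] that unfolding L_def by simp
  have "L 0 + L 1 + L 2 = (\<Sum>ij\<in>?I. l ij * (d 0 ij + d 1 ij + d 2 ij))"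
    by (simp add: L_def sum.distrib distrib_left)
  also have "\<dots> = 0"
    by (rule sum.neutral) (auto simp: d_def less_3_iff)
  finally have "L 0 + L 1 + L 2 = 0" .
  \<comment> \<open>All three are the derivative of one and the same function of \<open>s\<close>,
    so they are equal; as their sum is zero, each of them vanishes.\<close>
  moreover have "L 1 = L 0" "L 2 = L 0"
    using DERIV_unique[OF der[of 1] der[of 0]] DERIV_unique[OF der[of 2] der[of 0]] by simp_all
  ultimately have "L 0 = 0" by simp
  with der[of 0] show ?thesis by simp
qed

text \<open>A test point for functions of the variables 0, 1 and 3 alone. Unlike in
  \<open>pt\<close>, coordinate 1 is the argument itself, so it can be given either \<open>z\<close>
  or \<open>z^2\<close>.\<close>

definition cpt :: "complex \<Rightarrow> complex \<Rightarrow> complex \<Rightarrow> nat \<Rightarrow> complex" where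
  "cpt t s D i = (if i = 0 then t else if i = 1 then s else if i = 3 then D else 0)"

lemma polyfun_pt:
  assumes "p \<in> polyfun {0,1,3}"
  shows "p (pt t z D) = p (cpt t (z ^ 2) D)"
  by (rule polyfun_cong[OF assms]) (auto simp: pt_def cpt_def)

text \<open>On the slice \<open>F\<close> equals \<open>A + z E\<close> with \<open>A\<close>,
  \<open>E\<close> polynomials in \<open>t, z^2, D\<close>. The stray term \<open>z E(t,0,0)\<close>
  is excluded by the derivative at zero, so \<open>E = z^2 B + D C\<close>, and \<open>z^3\<close>
  and \<open>z D\<close> appear as the values of \<open>x 2\<close> and \<open>x 4\<close>.\<close>

lemma U_invariant_is_phi:
  assumes F: "F \<in> U_invariants M1"
  obtains P where "P \<in> polyfun {..<5}" "F = phi P"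
proof -
  let ?I = "{..<3} \<times> {..<3} :: (nat \<times> nat) set" and ?V = "{0,1,3} :: nat set"
  obtain p where p: "p \<in> polyfun ?I" "\<And>A. A \<in> M1 \<Longrightarrow> F A = p (\<lambda>ij. A $$ ij)"
    using F by (auto simp: U_invariants_def coord_ring_def mat_polyfun_def restr_def M1_carrier)
  define e :: "nat \<times> nat \<Rightarrow> (nat \<Rightarrow> complex) \<Rightarrow> complex" where
    "e ij x = slice (x 0) (x 1) (x 3) $$ ij" for ij x
  have "e ij \<in> polyfun ?V" if "ij \<in> ?I" for ij
  proof -
    obtain i j where ij: "ij = (i,j)" "i < 3" "j < 3" using \<open>ij \<in> ?I\<close> by auto
    let ?c = "\<lambda>b. if b then 1 else 0 :: complex"
    have "(\<lambda>x. ?c (i = j) * (1 / 3) * x 0 + (?c (i = j \<and> i = 2) * 2 - ?c (i = j \<and> i \<noteq> 2)) * x 1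
        + ?c (i = 2 \<and> j = 0) * x 3) \<in> polyfun ?V"
      by (intro polyfun_intros) simp_all
    moreover have "e ij = (\<lambda>x. ?c (i = j) * (1 / 3) * x 0 + (?c (i = j \<and> i = 2) * 2 - ?c (i = j \<and> i \<noteq> 2)) * x 1
        + ?c (i = 2 \<and> j = 0) * x 3)"
      unfolding e_def[abs_def] ij(1) slice_index[OF ij(2,3)] by auto
    ultimately show ?thesis by simp
  qed
  then have Q: "(\<lambda>x. p (\<lambda>ij. e ij x)) \<in> polyfun ?V" by (rule polyfun_compose[OF p(1)])
  obtain A E where AE: "A \<in> polyfun ?V" "E \<in> polyfun ?V"
    "\<And>x. p (\<lambda>ij. e ij x) = A (x(1 := x 1 ^ 2)) + x 1 * E (x(1 := x 1 ^ 2))"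
    using polyfun_even_odd[OF Q, of 1] by blast
  have F_slice: "F (slice t z D) = A (cpt t (z ^ 2) D) + z * E (cpt t (z ^ 2) D)" for t z D
  proof -
    have "F (slice t z D) = p (\<lambda>ij. e ij (cpt t z D))"
      unfolding p(2)[OF slice_in_M1] e_def by (simp add: cpt_def)
    moreover have "(cpt t z D)(1 := cpt t z D 1 ^ 2) = cpt t (z ^ 2) D" "cpt t z D 1 = z"
      by (auto simp: cpt_def)
    ultimately show ?thesis unfolding AE(3) by simp
  qed
  have E0: "E (cpt t 0 0) = 0" for t
  proof -
    have diff: "\<exists>c. ((\<lambda>s. cpt t s 0 i) has_field_derivative c) (at 0)" for i
      unfolding cpt_def by (cases "i = 0"; cases "i = 1") (auto intro: DERIV_const DERIV_ident)
    obtain a' e' where der: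
      "((\<lambda>s. A (cpt t s 0)) has_field_derivative a') (at 0)"
      "((\<lambda>s. E (cpt t s 0)) has_field_derivative e') (at 0)"
      using polyfun_field_differentiable[OF AE(1), where f = "\<lambda>i s. cpt t s 0 i" and a = 0, OF diff]
        polyfun_field_differentiable[OF AE(2), where f = "\<lambda>i s. cpt t s 0 i" and a = 0, OF diff] by blast
    have sq: "((\<lambda>s::complex. s ^ 2) has_field_derivative 0) (at 0)"
      by (auto intro!: derivative_eq_intros)
    \<comment> \<open>Composed with \<open>s^2\<close>, both functions are stationary at
      \<open>0\<close>; by the product rule only the value \<open>E (cpt t 0 0)\<close> survives in
      the derivative.\<close>
    have "((\<lambda>s. A (cpt t (s ^ 2) 0)) has_field_derivative a' * 0) (at 0)"
      "((\<lambda>s. E (cpt t (s ^ 2) 0)) has_field_derivative e' * 0) (at 0)"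
      by (rule DERIV_chain2[OF _ sq], simp add: der)+
    from DERIV_add[OF this(1) DERIV_mult[OF DERIV_ident this(2)]]
    have "((\<lambda>s. F (slice t s 0)) has_field_derivative E (cpt t 0 0)) (at 0)"
      unfolding F_slice by simp
    then show ?thesis using DERIV_unique U_invariant_slice_derivative[OF F] by blast
  qed
  obtain C where C: "C \<in> polyfun ?V" "\<And>x. E x = E (x(3 := 0)) + x 3 * C x"
    using polyfun_split_var[OF AE(2), of 3] by auto
  \<comment> \<open>The remainder of \<open>E\<close> modulo \<open>x 3\<close> is divided once
    more, by \<open>x 1\<close>; the new remainder is \<open>E\<close> at
    \<open>x 1 = x 3 = 0\<close>, which \<open>E0\<close> kills.\<close>
  have "(\<lambda>x. E (x(3 := 0))) \<in> polyfun {0,1}"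
    by (rule polyfun_mono[OF polyfun_fix_var[OF AE(2)]]) auto
  from polyfun_split_var[OF this, of 1]
  obtain B where B: "B \<in> polyfun {0,1}" "\<And>x. E (x(3 := 0)) = E (x(1 := 0, 3 := 0)) + x 1 * B x"
    by auto
  have E: "E (cpt t s D) = s * B (cpt t s D) + D * C (cpt t s D)" for t s D
  proof -
    have "(cpt t s D)(1 := 0, 3 := 0) = cpt t 0 0" by (auto simp: cpt_def)
    then have "E ((cpt t s D)(3 := 0)) = s * B (cpt t s D)"
      using B(2)[of "cpt t s D"] E0 by (simp add: cpt_def)
    then show ?thesis using C(2)[of "cpt t s D"] by (simp add: cpt_def)
  qed
  let ?P = "\<lambda>x. A x + x 2 * B x + x 4 * C x"
  have B': "B \<in> polyfun ?V" by (rule polyfun_mono[OF B(1)]) auto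
  have "A \<in> polyfun {..<5}" "B \<in> polyfun {..<5}" "C \<in> polyfun {..<5}"
    using polyfun_mono[OF AE(1), of "{..<5}"] polyfun_mono[OF B', of "{..<5}"] polyfun_mono[OF C(1), of "{..<5}"]
    by auto
  then have "?P \<in> polyfun {..<5}" by (intro polyfun_intros) simp_all
  moreover have "F = phi ?P"
  proof
    fix M
    show "F M = phi ?P M"
    proof (cases "M \<in> M1")
      case True
      then obtain t v w where M: "M = rk1 t v w" using M1_iff_rk1 by blast
      have "F (slice t z D) = ?P (pt t z D)" for z D
      proof -
        have "F (slice t z D) = A (cpt t (z\<^sup>2) D) + z * (z\<^sup>2 * B (cpt t (z\<^sup>2) D) + D * C (cpt t (z\<^sup>2) D))"
          unfolding F_slice E ..
        moreover have "pt t z D 2 = z ^ 3" "pt t z D 4 = z * D" by (simp_all add: pt_def)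
        ultimately show ?thesis
          by (simp add: polyfun_pt[OF AE(1)] polyfun_pt[OF B'] polyfun_pt[OF C(1)]
              algebra_simps power2_eq_square power3_eq_cube)
      qed
      then show ?thesis unfolding M phi_rk1 U_invariant_eq_slice[OF F] .
    next
      case False
      then show ?thesis using U_invariants_outside[OF F] phi_outside by simp
    qed
  qed
  ultimately show thesis by (rule that)
qed

section \<open>The ideal of relations\<close>

lemma rel_idealI:
  assumes "h0 \<in> polyfun {..<5}" "h1 \<in> polyfun {..<5}" "h2 \<in> polyfun {..<5}" "h3 \<in> polyfun {..<5}"
    and f: "\<And>x. f x = h0 x * (x 1 ^ 3 - x 2 ^ 2) + h1 x * (x 1 * x 4 - x 2 * x 3)
      + h2 x * (x 4 ^ 2 - x 1 * x 3 ^ 2) + h3 x * (x 2 * x 4 - x 1 ^ 2 * x 3)"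
  shows "f \<in> rel_ideal"
proof -
  let ?h = "\<lambda>k :: nat. if k = 0 then h0 else if k = 1 then h1 else if k = 2 then h2 else h3"
  have "f = (\<lambda>x. \<Sum>k<4. ?h k x * rel k x)"
    by (rule ext) (simp add: f rel_def lessThan_nat_numeral lessThan_Suc eval_nat_numeral algebra_simps)
  moreover have "\<forall>k<4. ?h k \<in> polyfun {..<5}" using assms(1-4) by simp
  ultimately show ?thesis
    unfolding rel_ideal_def mem_Collect_eq by (intro exI[of _ ?h] conjI)
qed

lemma rel_ideal_add:
  assumes "f \<in> rel_ideal" "g \<in> rel_ideal"
  shows "(\<lambda>x. f x + g x) \<in> rel_ideal"
proof -
  obtain h where h: "f = (\<lambda>x. \<Sum>k<4. h k x * rel k x)" "\<forall>k<4. h k \<in> polyfun {..<5}"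
    using assms(1) by (auto simp: rel_ideal_def)
  obtain h' where h': "g = (\<lambda>x. \<Sum>k<4. h' k x * rel k x)" "\<forall>k<4. h' k \<in> polyfun {..<5}"
    using assms(2) by (auto simp: rel_ideal_def)
  show ?thesis unfolding rel_ideal_def mem_Collect_eq using h h'
    by (intro exI[of _ "\<lambda>k x. h k x + h' k x"]) (auto intro: pf_add simp: distrib_right sum.distrib)
qed

lemma rel_ideal_mult:
  assumes "f \<in> rel_ideal" "q \<in> polyfun {..<5}"
  shows "(\<lambda>x. q x * f x) \<in> rel_ideal"
proof -
  obtain h where h: "f = (\<lambda>x. \<Sum>k<4. h k x * rel k x)" "\<forall>k<4. h k \<in> polyfun {..<5}"
    using assms(1) by (auto simp: rel_ideal_def)
  show ?thesis unfolding rel_ideal_def mem_Collect_eq using h assms(2)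
    by (intro exI[of _ "\<lambda>k x. q x * h k x"]) (auto intro: pf_mult simp: sum_distrib_left mult.assoc)
qed

lemma rel_ideal_vanishes:
  assumes "f \<in> rel_ideal"
  shows "f (pt t z D) = 0"
proof -
  have "(\<lambda>k. rel k (pt t z D)) = (\<lambda>k. 0)"
    by (auto simp: rel_def pt_def power2_eq_square power3_eq_cube)
  then have "rel k (pt t z D) = 0" for k by metis
  then show ?thesis using assms by (auto simp: rel_ideal_def)
qed

text \<open>The relations act as rewrite rules: \<open>x2^2\<close> to \<open>x1^3\<close>,
  \<open>x2 x3\<close> to \<open>x1 x4\<close>, \<open>x4^2\<close> to \<open>x1 x3^2\<close>, and
  \<open>x2 x4\<close> to \<open>x1^2 x3\<close>. The second one is why \<open>B\<close> can be kept
  free of \<open>x 3\<close>.\<close>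

lemma rel_ideal_normal_form:
  assumes "P \<in> polyfun {..<5}"
  shows "\<exists>A \<in> polyfun {0,1,3}. \<exists>B \<in> polyfun {0,1}. \<exists>C \<in> polyfun {0,1,3}.
    (\<lambda>x. P x - (A x + x 2 * B x + x 4 * C x)) \<in> rel_ideal"
  using assms
proof induction
  have nfI: "\<exists>A \<in> polyfun {0,1,3}. \<exists>B \<in> polyfun {0,1}. \<exists>C \<in> polyfun {0,1,3}.
      (\<lambda>x. P x - (A x + x 2 * B x + x 4 * C x)) \<in> rel_ideal"
    if "A \<in> polyfun {0,1,3}" "B \<in> polyfun {0,1}" "C \<in> polyfun {0,1,3}"
      "(\<lambda>x. P x - (A x + x 2 * B x + x 4 * C x)) \<in> rel_ideal" for P A B C
    using that by blast
  have zero: "(\<lambda>x. 0) \<in> rel_ideal"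
    unfolding rel_ideal_def mem_Collect_eq by (intro exI[of _ "\<lambda>k x. 0"]) (auto intro: pf_const)
  {
    case (pf_const c)
    show ?case
      by (rule nfI[of "\<lambda>x. c" "\<lambda>x. 0" "\<lambda>x. 0"]) (simp_all add: zero polyfun.pf_const)
  next
    case (pf_var i)
    then consider "i \<in> {0,1,3}" | "i = 2" | "i = 4" by fastforce
    then show ?case
    proof cases
      case 1
      then show ?thesis
        by (intro nfI[of "\<lambda>x. x i" "\<lambda>x. 0" "\<lambda>x. 0"])
          (simp_all add: zero polyfun.pf_const polyfun.pf_var)
    next
      case 2
      then show ?thesis
        by (intro nfI[of "\<lambda>x. 0" "\<lambda>x. 1" "\<lambda>x. 0"])
          (simp_all add: zero polyfun.pf_const)
    next
      case 3
      then show ?thesis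
        by (intro nfI[of "\<lambda>x. 0" "\<lambda>x. 0" "\<lambda>x. 1"])
          (simp_all add: zero polyfun.pf_const)
    qed
  next
    case (pf_add p q)
    then obtain A B C A' B' C' where *:
      "A \<in> polyfun {0,1,3}" "B \<in> polyfun {0,1}" "C \<in> polyfun {0,1,3}"
      "(\<lambda>x. p x - (A x + x 2 * B x + x 4 * C x)) \<in> rel_ideal"
      "A' \<in> polyfun {0,1,3}" "B' \<in> polyfun {0,1}" "C' \<in> polyfun {0,1,3}"
      "(\<lambda>x. q x - (A' x + x 2 * B' x + x 4 * C' x)) \<in> rel_ideal" by blast
    have "(\<lambda>x. p x + q x - (A x + A' x + x 2 * (B x + B' x) + x 4 * (C x + C' x))) \<in> rel_ideal"
      using rel_ideal_add[OF *(4,8)] by (simp add: algebra_simps)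
    then show ?case
      by (rule nfI[rotated -1]) (intro polyfun.pf_add *)+
  next
    case (pf_mult p q)
    then obtain A B C A' B' C' where *:
      "A \<in> polyfun {0,1,3}" "B \<in> polyfun {0,1}" "C \<in> polyfun {0,1,3}"
      "(\<lambda>x. p x - (A x + x 2 * B x + x 4 * C x)) \<in> rel_ideal"
      "A' \<in> polyfun {0,1,3}" "B' \<in> polyfun {0,1}" "C' \<in> polyfun {0,1,3}"
      "(\<lambda>x. q x - (A' x + x 2 * B' x + x 4 * C' x)) \<in> rel_ideal" by blast
    \<comment> \<open>The products \<open>x 2 * A * B'\<close> and \<open>x 2 * A' * B\<close> are
      not yet normal when \<open>A\<close> or \<open>A'\<close> involves \<open>x 3\<close>; their
      part divisible by \<open>x 3\<close> is moved to \<open>x 4\<close> by the rule for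
      \<open>x2 x3\<close>.\<close>
    obtain A1 where A1: "A1 \<in> polyfun {0,1,3}" "\<And>x. A x = A (x(3 := 0)) + x 3 * A1 x"
      using polyfun_split_var[OF *(1), of 3] by auto
    obtain A1' where A1': "A1' \<in> polyfun {0,1,3}" "\<And>x. A' x = A' (x(3 := 0)) + x 3 * A1' x"
      using polyfun_split_var[OF *(5), of 3] by auto
    define A0 A0' where "A0 x = A (x(3 := 0))" and "A0' x = A' (x(3 := 0))" for x
    have A0: "A0 \<in> polyfun {0,1}" "A0' \<in> polyfun {0,1}"
      unfolding A0_def[abs_def] A0'_def[abs_def]
      using polyfun_mono[OF polyfun_fix_var[OF *(1), of 3 0], of "{0,1}"]
        polyfun_mono[OF polyfun_fix_var[OF *(5), of 3 0], of "{0,1}"] by auto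
    have B3: "B \<in> polyfun {0,1,3}" "B' \<in> polyfun {0,1,3}"
      using polyfun_mono[OF *(2), of "{0,1,3}"] polyfun_mono[OF *(6), of "{0,1,3}"] by auto
    have sub: "f \<in> polyfun {..<5}" if "f \<in> polyfun {0,1,3}" for f :: "(nat \<Rightarrow> complex) \<Rightarrow> complex"
      using polyfun_mono[OF that, of "{..<5}"] by auto
    note five = sub[OF *(1)] sub[OF *(3)] sub[OF *(5)] sub[OF *(7)] sub[OF B3(1)] sub[OF B3(2)]
      sub[OF A1(1)] sub[OF A1'(1)]
    let ?N = "\<lambda>x. A x + x 2 * B x + x 4 * C x" and ?N' = "\<lambda>x. A' x + x 2 * B' x + x 4 * C' x"
    let ?A = "\<lambda>x. A x * A' x + x 1 ^ 3 * (B x * B' x) + x 1 ^ 2 * x 3 * (B x * C' x + B' x * C x)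
      + x 1 * x 3 ^ 2 * (C x * C' x)"
    let ?B = "\<lambda>x. A0 x * B' x + A0' x * B x"
    let ?C = "\<lambda>x. A x * C' x + A' x * C x + x 1 * (A1 x * B' x + A1' x * B x)"
    have "?N \<in> polyfun {..<5}" by (intro polyfun_intros five) simp_all
    from rel_ideal_add[OF rel_ideal_mult[OF *(4) pf_mult.hyps(2)] rel_ideal_mult[OF *(8) this]]
    have 1: "(\<lambda>x. q x * (p x - ?N x) + ?N x * (q x - ?N' x)) \<in> rel_ideal" .
    have 2: "(\<lambda>x. ?N x * ?N' x - (?A x + x 2 * ?B x + x 4 * ?C x)) \<in> rel_ideal"
    proof (rule rel_idealI)
      fix x
      have "A x = A0 x + x 3 * A1 x" "A' x = A0' x + x 3 * A1' x"
        using A1(2)[of x] A1'(2)[of x] by (simp_all add: A0_def A0'_def)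
      then show "?N x * ?N' x - (?A x + x 2 * ?B x + x 4 * ?C x)
        = - (B x * B' x) * (x 1 ^ 3 - x 2 ^ 2) + - (A1 x * B' x + A1' x * B x) * (x 1 * x 4 - x 2 * x 3)
        + C x * C' x * (x 4 ^ 2 - x 1 * x 3 ^ 2) + (B x * C' x + B' x * C x) * (x 2 * x 4 - x 1 ^ 2 * x 3)"
        by (simp only:) (simp add: algebra_simps power2_eq_square power3_eq_cube)
      show "(\<lambda>x. - (B x * B' x)) \<in> polyfun {..<5}"
        "(\<lambda>x. - (A1 x * B' x + A1' x * B x)) \<in> polyfun {..<5}"
        "(\<lambda>x. C x * C' x) \<in> polyfun {..<5}"
        "(\<lambda>x. B x * C' x + B' x * C x) \<in> polyfun {..<5}"
        by (intro polyfun_intros five)+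
    qed
    show ?case
    proof (rule nfI)
      show "(\<lambda>x. p x * q x - (?A x + x 2 * ?B x + x 4 * ?C x)) \<in> rel_ideal"
      proof -
        have "q x * (p x - n) + n * (q x - n') + (n * n' - m) = p x * q x - m" for x n n' m
          by (simp add: algebra_simps)
        with rel_ideal_add[OF 1 2] show ?thesis by (simp only:)
      qed
      show "?A \<in> polyfun {0,1,3}" by (intro polyfun_intros * B3) simp_all
      show "?B \<in> polyfun {0,1}" by (intro polyfun_intros * A0)
      show "?C \<in> polyfun {0,1,3}" by (intro polyfun_intros * B3 A1(1) A1'(1)) simp_all
    qed
  }
qed

section \<open>Polynomials vanishing on the parametrised points\<close>

lemma isCont_cpt: "isCont f a \<Longrightarrow> isCont g a \<Longrightarrow> isCont (\<lambda>s. cpt t (f s) (g s) i) a"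
  unfolding cpt_def by (cases "i = 0"; cases "i = 1"; cases "i = 3") simp_all

text \<open>It suffices that a normal form vanishing at all points \<open>pt t z D\<close> is zero.
  Parity in \<open>z\<close> isolates \<open>A\<close>, setting \<open>D = 0\<close> isolates
  \<open>B\<close>, and then \<open>C\<close> remains alone.\<close>

lemma vanishing_in_rel_ideal:
  assumes P: "P \<in> polyfun {..<5}" and van: "\<And>t z D. P (pt t z D) = 0"
  shows "P \<in> rel_ideal"
proof -
  let ?V = "{0,1,3} :: nat set"
  obtain A B C where *: "A \<in> polyfun ?V" "B \<in> polyfun {0,1}" "C \<in> polyfun ?V"
    and I: "(\<lambda>x. P x - (A x + x 2 * B x + x 4 * C x)) \<in> rel_ideal"
    using rel_ideal_normal_form[OF P] by blast
  have B: "B \<in> polyfun ?V" by (rule polyfun_mono[OF *(2)]) auto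
  define a b c where "a t s D = A (cpt t s D)" and "b t s = B (cpt t s 0)" and "c t s D = C (cpt t s D)" for t s D
  \<comment> \<open>\<open>B\<close> does not see \<open>D\<close>, so what is learnt about it at
    \<open>D = 0\<close> holds for every \<open>D\<close>.\<close>
  have b: "B (cpt t s D) = b t s" for t s D
    unfolding b_def by (rule polyfun_cong[OF *(2)]) (auto simp: cpt_def)
  have eq: "a t (z ^ 2) D + z ^ 3 * b t (z ^ 2) + z * D * c t (z ^ 2) D = 0" for t z D
  proof -
    have pt: "pt t z D 2 = z ^ 3" "pt t z D 4 = z * D" by (simp_all add: pt_def)
    have "0 - (a t (z ^ 2) D + z ^ 3 * b t (z ^ 2) + z * D * c t (z ^ 2) D) = 0"
      using rel_ideal_vanishes[OF I, of t z D]
      unfolding van pt polyfun_pt[OF *(1)] polyfun_pt[OF B] polyfun_pt[OF *(3)] b a_def c_def .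
    then show ?thesis by (simp only: diff_0 neg_equal_0_iff_equal)
  qed
  have a0: "a t (z ^ 2) D = 0" and bc: "z ^ 3 * b t (z ^ 2) + z * D * c t (z ^ 2) D = 0" for t z D
  proof -
    let ?u = "z ^ 3 * b t (z ^ 2) + z * D * c t (z ^ 2) D"
    have 1: "a t (z ^ 2) D + ?u = 0" using eq[of t z D] by (simp only: add.assoc)
    \<comment> \<open>Replacing \<open>z\<close> by \<open>- z\<close> keeps the first term and
      negates the other two.\<close>
    have 2: "a t (z ^ 2) D - ?u = 0" using eq[of t "- z" D] by (simp add: algebra_simps)
    have "2 * a t (z ^ 2) D = (a t (z ^ 2) D + ?u) + (a t (z ^ 2) D - ?u)" by simp
    then show "a t (z ^ 2) D = 0" unfolding 1 2 by simp
    with 1 show "?u = 0" by simp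
  qed
  have a: "a t s D = 0" for t s D using a0[of t "csqrt s" D] by simp
  have bc': "s * b t s + D * c t s D = 0" if "s \<noteq> 0" for t s D
  proof -
    \<comment> \<open>Every \<open>s\<close> is a square, and for \<open>s\<close> nonzero a common
      factor \<open>z = csqrt s\<close> can be cancelled; the excluded values are recovered by
      continuity.\<close>
    have "csqrt s * (s * b t s + D * c t s D) = 0"
      using bc[of "csqrt s" t D] by (simp add: algebra_simps power3_eq_cube flip: power2_eq_square)
    then show ?thesis using that by simp
  qed
  have b_nz: "b t s = 0" if "s \<noteq> 0" for t s using bc'[OF that, of t 0] that by simp
  have c_nz: "c t s D = 0" if "s \<noteq> 0" "D \<noteq> 0" for t s D
    using bc'[OF that(1), of t D] b_nz[OF that(1)] that(2) by simp
  have b0: "b t s = 0" for t s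
  proof (cases "s = 0")
    case True
    have "isCont (b t) 0" unfolding b_def[abs_def]
      by (intro polyfun_isCont[OF B] isCont_cpt) simp_all
    then have "b t 0 = 0"
      by (rule isCont_eq_at_limit[of 0 "b t" "\<lambda>_. 0", OF _ continuous_const])
        (simp add: eventually_at_filter b_nz)
    with True show ?thesis by simp
  qed (rule b_nz)
  \<comment> \<open>Two limits follow each other: \<open>s\<close> to \<open>0\<close> with
    \<open>D\<close> nonzero and fixed, then \<open>D\<close> to \<open>0\<close>.\<close>
  have c1: "c t s D = 0" if "D \<noteq> 0" for t s D
  proof (cases "s = 0")
    case True
    have "isCont (\<lambda>s. c t s D) 0" unfolding c_def
      by (intro polyfun_isCont[OF *(3)] isCont_cpt) simp_all
    then have "c t 0 D = 0"
      by (rule isCont_eq_at_limit[of 0 "\<lambda>s. c t s D" "\<lambda>_. 0", OF _ continuous_const])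
        (simp add: eventually_at_filter c_nz that)
    with True show ?thesis by simp
  qed (use that in \<open>simp add: c_nz\<close>)
  have c0: "c t s D = 0" for t s D
  proof (cases "D = 0")
    case True
    have "isCont (\<lambda>D. c t s D) 0" unfolding c_def
      by (intro polyfun_isCont[OF *(3)] isCont_cpt) simp_all
    then have "c t s 0 = 0"
      by (rule isCont_eq_at_limit[of 0 "\<lambda>D. c t s D" "\<lambda>_. 0", OF _ continuous_const])
        (simp add: eventually_at_filter c1)
    with True show ?thesis by simp
  qed (rule c1)
  have "p x = p (cpt (x 0) (x 1) (x 3))" if "p \<in> polyfun ?V" for p x
    by (rule polyfun_cong[OF that]) (auto simp: cpt_def)
  from this[OF *(1)] this[OF B] this[OF *(3)] have "A x = 0" "B x = 0" "C x = 0" for x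
    using a b0 c0 by (simp_all add: a_def b c_def)
  with I show ?thesis by simp
qed

lemma phi_eq_0_iff:
  assumes "P \<in> polyfun {..<5}"
  shows "phi P = (\<lambda>A. 0) \<longleftrightarrow> P \<in> rel_ideal"
proof
  assume "phi P = (\<lambda>A. 0)"
  then have "P (pt t z D) = 0" for t z D
    using phi_slice[of P t z D] by simp
  then show "P \<in> rel_ideal" by (rule vanishing_in_rel_ideal[OF assms])
next
  assume I: "P \<in> rel_ideal"
  show "phi P = (\<lambda>A. 0)"
  proof
    fix A show "phi P A = 0"
    proof (cases "A \<in> M1")
      case True
      then obtain t v w where "A = rk1 t v w" using M1_iff_rk1 by blast
      then show ?thesis by (simp add: phi_rk1 rel_ideal_vanishes[OF I])
    qed (rule phi_outside)
  qed
qed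

section \<open>The algebra of U-invariants\<close>

text \<open>The subalgebra is the image of the five-variable polynomials under substitution of
  \<open>0, z^2, z^3, D, z D\<close>. So its elements can be compared with invariants through a
  common \<open>P\<close>.\<close>

lemma zD_subalg_iff: "p \<in> zD_subalg \<longleftrightarrow> (\<exists>P \<in> polyfun {..<5}. p = (\<lambda>x. P (pt 0 (x 0) (x 1))))"
proof
  assume "p \<in> zD_subalg"
  then show "\<exists>P \<in> polyfun {..<5}. p = (\<lambda>x. P (pt 0 (x 0) (x 1)))"
    unfolding zD_subalg_def
  proof induction
    case (ga_const c)
    show ?case by (rule bexI[of _ "\<lambda>x. c"]) (simp_all add: pf_const)
  next
    case (ga_gen g)
    then consider "g = (\<lambda>x. x 0 ^ 2)" | "g = (\<lambda>x. x 0 ^ 3)" | "g = (\<lambda>x. x 1)" | "g = (\<lambda>x. x 0 * x 1)"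
      by auto
    then show ?case
    proof cases
      case 1
      then show ?thesis by (intro bexI[of _ "\<lambda>x. x 1"]) (simp_all add: pf_var pt_def)
    next
      case 2
      then show ?thesis by (intro bexI[of _ "\<lambda>x. x 2"]) (simp_all add: pf_var pt_def)
    next
      case 3
      then show ?thesis by (intro bexI[of _ "\<lambda>x. x 3"]) (simp_all add: pf_var pt_def)
    next
      case 4
      then show ?thesis by (intro bexI[of _ "\<lambda>x. x 4"]) (simp_all add: pf_var pt_def)
    qed
  next
    case (ga_add p q)
    then obtain P Q where "P \<in> polyfun {..<5}" "p = (\<lambda>x. P (pt 0 (x 0) (x 1)))"
      "Q \<in> polyfun {..<5}" "q = (\<lambda>x. Q (pt 0 (x 0) (x 1)))" by blast
    then show ?case by (intro bexI[of _ "\<lambda>x. P x + Q x"]) (simp_all add: pf_add)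
  next
    case (ga_mult p q)
    then obtain P Q where "P \<in> polyfun {..<5}" "p = (\<lambda>x. P (pt 0 (x 0) (x 1)))"
      "Q \<in> polyfun {..<5}" "q = (\<lambda>x. Q (pt 0 (x 0) (x 1)))" by blast
    then show ?case by (intro bexI[of _ "\<lambda>x. P x * Q x"]) (simp_all add: pf_mult)
  qed
next
  have "(\<lambda>x. P (pt 0 (x 0) (x 1))) \<in> zD_subalg" if "P \<in> polyfun {..<5}" for P
    using that
  proof induction
    case (pf_const c)
    show ?case unfolding zD_subalg_def by (rule ga_const)
  next
    case (pf_var i)
    then consider "i = 0" | "i = 1" | "i = 2" | "i = 3" | "i = 4" by fastforce
    then show ?case
      unfolding zD_subalg_def
      by cases (auto simp: pt_def intro!: ga_const ga_gen)
  next
    case (pf_add p q)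
    show ?case using pf_add.IH unfolding zD_subalg_def by (rule ga_add)
  next
    case (pf_mult p q)
    show ?case using pf_mult.IH unfolding zD_subalg_def by (rule ga_mult)
  qed
  then show "\<exists>P \<in> polyfun {..<5}. p = (\<lambda>x. P (pt 0 (x 0) (x 1))) \<Longrightarrow> p \<in> zD_subalg" by blast
qed

section \<open>Expansion in powers of the trace\<close>

lemma emb_rk1: "emb f (rk1 t v w) = f (rk1 0 v w)"
  using M1_iff_rk1 by (auto simp: emb_def restr_def c1_rk1)

lemma restr_M1_d1: "restr M1 d1 = phi (\<lambda>x. x 0)"
  by (simp add: phi_def)

text \<open>Expand \<open>P\<close> in powers of \<open>x 0\<close>, the variable of the trace. The
  coefficients do not involve the trace, so their images come from \<open>N1\<close>.\<close>

lemma U_invariants_M1_expand: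
  assumes F: "F \<in> U_invariants M1"
  shows "\<exists>n g. (\<forall>i\<le>n. g i \<in> U_invariants N1) \<and>
    F = (\<lambda>A. \<Sum>i\<le>n. emb (g i) A * restr M1 d1 A ^ i)"
proof -
  obtain P where P: "P \<in> polyfun {..<5}" "F = phi P" using U_invariant_is_phi[OF F] .
  obtain n :: nat and g where g: "\<And>k. g k \<in> polyfun ({..<5} - {0})" "\<And>x. P x = (\<Sum>k\<le>n. g k x * x 0 ^ k)"
    by (rule polyfun_expand_var[OF P(1), where i = 0]) (rule that)
  let ?g = "\<lambda>k. restr N1 (phi (g k))"
  have "?g k \<in> U_invariants N1" for k
    by (intro restr_N1_in_U_invariants phi_in_U_invariants polyfun_mono[OF g(1)]) auto
  moreover have "F = (\<lambda>A. \<Sum>i\<le>n. emb (?g i) A * restr M1 d1 A ^ i)"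
  proof
    fix A
    show "F A = (\<Sum>i\<le>n. emb (?g i) A * restr M1 d1 A ^ i)"
    proof (cases "A \<in> M1")
      case True
      then obtain t v w where A: "A = rk1 t v w" using M1_iff_rk1 by blast
      have "rk1 0 v w \<in> N1" using N1_iff_rk1 by blast
      moreover have "g k (pt 0 z D) = g k (pt t z D)" for k z D
        by (rule polyfun_cong[OF g(1)]) (auto simp: pt_def)
      ultimately have emb: "emb (?g k) A = phi (g k) A" for k
        unfolding A emb_rk1 by (simp add: restr_def phi_rk1)
      show ?thesis unfolding emb restr_M1_d1 P(2) unfolding A phi_rk1 by (rule g(2))
    next
      case False
      then show ?thesis using U_invariants_outside[OF F] by (simp add: emb_def restr_def)
    qed
  qed
  ultimately show ?thesis by (intro exI[of _ n, OF exI[of _ ?g]] conjI allI impI)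
qed

text \<open>With \<open>v\<close> and \<open>w\<close> fixed and \<open>t\<close> free, the relation
  is a polynomial identity in \<open>t\<close> whose coefficients are the values of the
  \<open>g i\<close> at one point of \<open>N1\<close>.\<close>

lemma U_invariants_N1_independent:
  assumes g: "\<And>i. i \<le> n \<Longrightarrow> g i \<in> U_invariants N1"
    and eq: "(\<lambda>A. \<Sum>i\<le>n. emb (g i) A * restr M1 d1 A ^ i) = (\<lambda>A. 0)"
    and i: "i \<le> n"
  shows "g i = (\<lambda>A. 0)"
proof
  fix A
  show "g i A = 0"
  proof (cases "A \<in> N1")
    case True
    then obtain v w where A: "A = rk1 0 v w" using N1_iff_rk1 by blast
    have "(\<Sum>i\<le>n. g i A * t ^ i) = 0" for t
      using fun_cong[OF eq, of "rk1 t v w"] unfolding emb_rk1 restr_M1_d1 phi_rk1 A by (simp add: pt_def)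
    then show ?thesis using polyfun_eq_0[of "\<lambda>i. g i A" n] i by blast
  next
    case False
    then show ?thesis using U_invariants_outside[OF g[OF i]] by simp
  qed
qed

text \<open>On \<open>N1\<close> the quotient \<open>d3 / d2\<close> recovers \<open>z\<close>, including where \<open>d2 = 0\<close>, since then \<open>z = 0 = 0 / 0\<close>.\<close>

definition eta :: "((nat \<Rightarrow> complex) \<Rightarrow> complex) \<Rightarrow> complex mat \<Rightarrow> complex" where
  "eta p = restr N1 (\<lambda>A. p (\<lambda>i. if i = 0 then d3 A / d2 A else c1U A))"

text \<open>The quotient in \<open>eta\<close> disappears on the subalgebra: there
  \<open>eta\<close> yields restrictions of \<open>phi P\<close>, which are regular and
  invariant.\<close>

lemma eta_pt: "eta (\<lambda>x. P (pt 0 (x 0) (x 1))) = restr N1 (phi P)"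
proof
  fix A
  show "eta (\<lambda>x. P (pt 0 (x 0) (x 1))) A = restr N1 (phi P) A"
  proof (cases "A \<in> N1")
    case True
    then obtain v w where A: "A = rk1 0 v w" using N1_iff_rk1 by blast
    have "z ^ 3 / z ^ 2 = z" for z :: complex
      by (cases "z = 0") (simp_all add: power2_eq_square power3_eq_cube)
    with True show ?thesis unfolding A by (simp add: eta_def restr_def covariants_rk1 phi_rk1)
  qed (simp add: eta_def restr_def)
qed

text \<open>Injectivity is read off at the points \<open>slice 0 z D\<close>, which realise all
  \<open>(z, D)\<close>. For surjectivity, \<open>emb f\<close> is some \<open>phi P\<close>, and
  restricting it to \<open>N1\<close> returns \<open>f\<close> because \<open>c1\<close> is the
  identity there.\<close>

lemma bij_betw_eta: "bij_betw eta zD_subalg (U_invariants N1)"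
proof (rule bij_betw_imageI)
  show "inj_on eta zD_subalg"
  proof (rule inj_onI)
    fix p q assume pq: "p \<in> zD_subalg" "q \<in> zD_subalg" "eta p = eta q"
    then obtain P Q where p: "p = (\<lambda>x. P (pt 0 (x 0) (x 1)))" and q: "q = (\<lambda>x. Q (pt 0 (x 0) (x 1)))"
      unfolding zD_subalg_iff by blast
    have "restr N1 (phi P) (slice 0 z D) = restr N1 (phi Q) (slice 0 z D)" for z D
      using pq(3) unfolding p q eta_pt by simp
    moreover have "slice 0 z D \<in> N1" for z D unfolding slice_def using N1_iff_rk1 by blast
    ultimately show "p = q" unfolding p q by (simp add: restr_def phi_slice)
  qed
  show "eta ` zD_subalg = U_invariants N1"
  proof (intro equalityI subsetI)
    fix f assume "f \<in> eta ` zD_subalg"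
    then obtain p where "p \<in> zD_subalg" "f = eta p" by blast
    then obtain P where "P \<in> polyfun {..<5}" "f = restr N1 (phi P)"
      unfolding zD_subalg_iff using eta_pt by blast
    then show "f \<in> U_invariants N1"
      by (simp add: restr_N1_in_U_invariants phi_in_U_invariants)
  next
    fix f assume f: "f \<in> U_invariants N1"
    obtain P where P: "P \<in> polyfun {..<5}" "emb f = phi P"
      using U_invariant_is_phi[OF emb_in_U_invariants[OF f]] .
    have "f A = restr N1 (emb f) A" for A
      using U_invariants_outside[OF f] N1_subset_M1 by (auto simp: restr_def emb_def c1_N1)
    then have "f = eta (\<lambda>x. P (pt 0 (x 0) (x 1)))" unfolding eta_pt P(2)[symmetric] by blast
    then show "f \<in> eta ` zD_subalg" using P(1) zD_subalg_iff by blast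
  qed
qed

lemma eta_generators:
  "eta (\<lambda>x. x 0 ^ 2) = restr N1 d2" "eta (\<lambda>x. x 0 ^ 3) = restr N1 d3"
  "eta (\<lambda>x. x 1) = restr N1 c1U" "eta (\<lambda>x. x 0 * x 1) = restr N1 c2U"
proof -
  have restr: "restr N1 (phi P) = restr N1 f" if "\<And>A. A \<in> M1 \<Longrightarrow> phi P A = f A" for P f
    using that N1_subset_M1 by (force simp: restr_def)
  show "eta (\<lambda>x. x 0 ^ 2) = restr N1 d2"
    using eta_pt[of "\<lambda>x. x 1"] restr[of "\<lambda>x. x 1" d2] by (simp add: pt_def phi_def restr_def)
  show "eta (\<lambda>x. x 0 ^ 3) = restr N1 d3"
    using eta_pt[of "\<lambda>x. x 2"] restr[of "\<lambda>x. x 2" d3] by (simp add: pt_def phi_def restr_def)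
  show "eta (\<lambda>x. x 1) = restr N1 c1U"
    using eta_pt[of "\<lambda>x. x 3"] restr[of "\<lambda>x. x 3" c1U] by (simp add: pt_def phi_def restr_def)
  show "eta (\<lambda>x. x 0 * x 1) = restr N1 c2U"
    using eta_pt[of "\<lambda>x. x 4"] restr[of "\<lambda>x. x 4" c2U] by (simp add: pt_def phi_def restr_def)
qed

lemma phi_image: "phi ` polyfun {..<5} = U_invariants M1"
proof
  show "phi ` polyfun {..<5} \<subseteq> U_invariants M1" using phi_in_U_invariants by blast
  show "U_invariants M1 \<subseteq> phi ` polyfun {..<5}"
  proof
    fix F assume "F \<in> U_invariants M1"
    then obtain P where "P \<in> polyfun {..<5}" "F = phi P" by (rule U_invariant_is_phi)
    then show "F \<in> phi ` polyfun {..<5}" by blast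
  qed
qed

theorem theorem4p5:
  shows
  \<comment> \<open>(i) C[M1]^U is a polynomial ring in d1-bar over the subalgebra C[N1]^U\<close>
  "(emb ` U_invariants N1 \<subseteq> U_invariants M1 \<and> restr M1 d1 \<in> U_invariants M1 \<and>
    (\<forall>F \<in> U_invariants M1. \<exists>n g. (\<forall>i\<le>n. g i \<in> U_invariants N1) \<and>
        F = (\<lambda>A. \<Sum>i\<le>n. emb (g i) A * restr M1 d1 A ^ i)) \<and>
    (\<forall>n g. (\<forall>i\<le>n. g i \<in> U_invariants N1) \<and>
        (\<lambda>A. \<Sum>i\<le>n. emb (g i) A * restr M1 d1 A ^ i) = (\<lambda>A. 0)
        \<longrightarrow> (\<forall>i\<le>n. g i = (\<lambda>A. 0))))
  \<and>
  \<comment> \<open>(ii) C-algebra isomorphism eta : C[z^2,z^3,D,zD] \<rightarrow> C[N1]^U\<close>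
   (\<exists>\<eta>. bij_betw \<eta> zD_subalg (U_invariants N1) \<and>
      (\<forall>p \<in> zD_subalg. \<forall>q \<in> zD_subalg.
          \<eta> (\<lambda>x. p x + q x) = (\<lambda>A. \<eta> p A + \<eta> q A) \<and>
          \<eta> (\<lambda>x. p x * q x) = (\<lambda>A. \<eta> p A * \<eta> q A)) \<and>
      (\<forall>c. \<eta> (\<lambda>x. c) = restr N1 (\<lambda>A. c)) \<and>
      \<eta> (\<lambda>x. x 0 ^ 2) = restr N1 d2 \<and>
      \<eta> (\<lambda>x. x 0 ^ 3) = restr N1 d3 \<and>
      \<eta> (\<lambda>x. x 1) = restr N1 c1U \<and>
      \<eta> (\<lambda>x. x 0 * x 1) = restr N1 c2U)
  \<and>
  \<comment> \<open>(iii) phi is onto C[M1]^U and its kernel is the ideal generated by the four relations\<close>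
   (phi ` polyfun {..<5} = U_invariants M1 \<and>
    (\<forall>P \<in> polyfun {..<5}. phi P = (\<lambda>A. 0) \<longleftrightarrow> P \<in> rel_ideal))"
proof (intro conjI exI[of _ eta] ballI allI impI)
  show "emb ` U_invariants N1 \<subseteq> U_invariants M1"
    using emb_in_U_invariants by blast
  show "restr M1 d1 \<in> U_invariants M1"
    unfolding restr_M1_d1 by (intro phi_in_U_invariants pf_var) simp
  show "\<exists>n g. (\<forall>i\<le>n. g i \<in> U_invariants N1) \<and> F = (\<lambda>A. \<Sum>i\<le>n. emb (g i) A * restr M1 d1 A ^ i)"
    if "F \<in> U_invariants M1" for F
    using U_invariants_M1_expand[OF that] .
  show "g i = (\<lambda>A. 0)"
    if "(\<forall>i\<le>n. g i \<in> U_invariants N1) \<and> (\<lambda>A. \<Sum>i\<le>n. emb (g i) A * restr M1 d1 A ^ i) = (\<lambda>A. 0)"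
      "i \<le> n" for n g i
    using U_invariants_N1_independent[of n g i] that by blast
  show "bij_betw eta zD_subalg (U_invariants N1)" by (rule bij_betw_eta)
  show "eta (\<lambda>x. p x + q x) = (\<lambda>A. eta p A + eta q A)" "eta (\<lambda>x. p x * q x) = (\<lambda>A. eta p A * eta q A)"
    for p q by (auto simp: eta_def restr_def)
  show "eta (\<lambda>x. c) = restr N1 (\<lambda>A. c)" for c by (simp add: eta_def)
  show "phi P = (\<lambda>A. 0) \<longleftrightarrow> P \<in> rel_ideal" if "P \<in> polyfun {..<5}" for P
    using phi_eq_0_iff[OF that] .
qed (rule eta_generators phi_image)+

end
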